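(* Let $s\geq 2$ be an integer and let $q$ be an integer with $0\leq q \leq 2\binom{s}{2}$. Then: \begin{itemize} \item if $0\leq q< \binom{s}{2}$ and $n\geq s$, then $\mathrm{ex}_{\Pi}(n,s,q)=0$; \item if $q=\binom{s}{2}$ and $n\geq s$, then $\mathrm{ex}_{\Pi}(n,s,q)=1$; \item if $\binom{s}{2} < q < \binom{s}{2}+ \lfloor s/2\rfloor$ and $n\geq s$, then $\mathrm{ex}_{\Pi}(n,s,q)=2^{q-\binom{s}{2}}$; \item if $\binom{s}{2}+ \lfloor s/2\rfloor \leq q < \binom{s}{2}+ s-2$, then $\mathrm{ex}_{\Pi}(n,s,q)=2^{\Theta(n)}$ as $n\to\infty$; \item if $q = \binom{s}{2}+ s-2$ and $n\geq s$, then $\mathrm{ex}_{\Pi}(n,s,q)=2^{\lfloor \frac{s-2}{s-1}n\rfloor}$; \item if $q = \binom{s}{2}+ s-1$ and $n\geq s$, then $\mathrm{ex}_{\Pi}(n,s,q)=2^{\mathrm{ex}(n, \{C_3, C_4, \ldots, C_{s}\})}$; \item if $\binom{s}{2}+ s\leq q< \binom{s}{2}+ \lfloor s^2/4\rfloor$, then $\mathrm{ex}_{\Pi}(n,s,q)=2^{o(n^2)}$ as $n\to\infty$; \item if $\binom{s}{2}+\lfloor s^2/4\rfloor \leq q \leq 2\binom{s}{2}$, then $\mathrm{ex}_{\Pi}(n,s,q)=2^{\Theta(n^2)}$ as $n\to\infty$. \end{itemize}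
   Context: A multigraph is a pair $G=(V,w)$ where $V$ is a finite set and $w:\binom{V}{2}\to\mathbb{Z}_{\geq 0}$. For $X\subseteq V$ write $e(G[X])=\sum_{xy\in\binom{X}{2}}w(xy)$ and $P(G)=\prod_{xy\in\binom{V}{2}}w(xy)$. Given integers $s\geq 2$, $q\geq 0$, $\mathcal{F}(n,s,q)$ denotes the set of multigraphs on vertex set $[n]=\{1,\dots,n\}$ in which every $s$-set $X$ of vertices satisfies $e(G[X])\leq q$, and $\mathrm{ex}_{\Pi}(n,s,q)=\max\{P(G): G\in\mathcal{F}(n,s,q)\}$. $\mathrm{ex}(n,\{C_3,\dots,C_s\})$ is the maximum number of edges in an $n$-vertex (simple) graph containing no cycle of length $\ell$ for any $3\le \ell\le s$ (i.e. of girth at least $s+1$). *)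

theory Defs
  imports Complex_Main "HOL-Library.Ramsey" "HOL-Library.Landau_Symbols"
begin

text \<open>A multigraph is a pair \<open>(V, w)\<close>. The library's \<open>nsets V 2\<close> plays the role of the set of
  2-subsets of \<open>V\<close>; the weight is made extensional so that it carries no information outside it.\<close>

type_synonym 'a multigraph = "'a set \<times> ('a set \<Rightarrow> nat)"

definition multigraph :: "'a multigraph \<Rightarrow> bool" where
  "multigraph G \<longleftrightarrow> finite (fst G) \<and> snd G \<in> extensional (nsets (fst G) 2)"

definition edge_sum :: "'a multigraph \<Rightarrow> 'a set \<Rightarrow> nat" where
  "edge_sum G X = (\<Sum>e\<in>nsets X 2. snd G e)"

definition edge_prod :: "'a multigraph \<Rightarrow> nat" where
  "edge_prod G = (\<Prod>e\<in>nsets (fst G) 2. snd G e)"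

definition sq_multigraphs :: "nat \<Rightarrow> nat \<Rightarrow> nat \<Rightarrow> nat multigraph set" where
  "sq_multigraphs n s q =
     {G. multigraph G \<and> fst G = {1..n} \<and> (\<forall>X\<in>nsets {1..n} s. edge_sum G X \<le> q)}"

text \<open>For \<open>n \<ge> s \<ge> 2\<close> all weights are at most \<open>q\<close>, so this is the maximum of a finite nonempty set.
  For \<open>n < s\<close> the maximum need not exist, and the value of \<open>Max\<close> is then meaningless.\<close>

definition ex_Pi :: "nat \<Rightarrow> nat \<Rightarrow> nat \<Rightarrow> nat" where
  "ex_Pi n s q = Max (edge_prod ` sq_multigraphs n s q)"

text \<open>A simple graph is given by its set of edges, which are 2-subsets of the vertex set. The cycle
  need not be induced.\<close>

definition has_cycle :: "'a set set \<Rightarrow> nat \<Rightarrow> bool" where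
  "has_cycle E l \<longleftrightarrow> l \<ge> 3 \<and>
     (\<exists>vs. length vs = l \<and> distinct vs \<and> (\<forall>i<l. {vs ! i, vs ! (Suc i mod l)} \<in> E))"

definition ex_cycles :: "nat \<Rightarrow> nat set \<Rightarrow> nat" where
  "ex_cycles n L = Max (card ` {E. E \<subseteq> nsets {1..n} 2 \<and> (\<forall>l\<in>L. \<not> has_cycle E l)})"

end

theory Submission
  imports Defs
begin

text \<open>
  A multigraph with nonzero product has all weights at least \<open>1\<close>; write its weights as
  \<open>x + 1\<close>. Every \<open>s\<close>-set then carries total excess \<open>x\<close> at most \<open>q\<close> minus \<open>s\<close> choose \<open>2\<close>,
  and since \<open>x + 1 \<le> 2 ^ x\<close> the product is at most \<open>2\<close> to the total excess.

  If \<open>s\<close>-sets carry excess at most \<open>k \<le> s - 2\<close>, then \<open>n\<close> vertices carry at most \<open>k n / (s - 1)\<close>: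
  a smallest union of components that is denser than this is a single component with fewer than
  \<open>s\<close> vertices, and removing it lowers both \<open>s\<close> and \<open>k\<close>, so induction on \<open>s\<close> applies.

  If \<open>s\<close>-sets carry excess at most \<open>s - 1\<close>, the total excess is dominated by the number of edges of
  a graph of girth larger than \<open>s\<close>: a set of at most \<open>s\<close> vertices with excess larger than its size
  forces total excess below \<open>n\<close> by the linear bound; one with excess equal to its size can be
  replaced by pendant vertices; in the absence of such sets \<open>x\<close> is itself such a graph.

  If \<open>s\<close>-sets carry excess below \<open>\<lfloor>s\<^sup>2 / 4\<rfloor>\<close>, the support of \<open>x\<close> contains no complete bipartite
  graph with \<open>s\<close> vertices and balanced parts, hence has \<open>o(n\<^sup>2)\<close> edges by the double counting of
  Kovari, Sos and Turan. The lower bounds give weight \<open>2\<close> to the edges of a matching, of disjoint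
  stars, of a graph of large girth, and of a balanced complete bipartite graph.
\<close>

section \<open>Edge weights and the linear bound\<close>

definition total_weight :: "('a set \<Rightarrow> nat) \<Rightarrow> 'a set \<Rightarrow> nat" where
  "total_weight x X = sum x (nsets X 2)"

lemma finite_nsets2 [simp]: "finite X \<Longrightarrow> finite (nsets X 2)"
  by (rule finite_imp_finite_nsets)

lemma card_nsets2: "finite X \<Longrightarrow> card (nsets X 2) = card X choose 2"
  by (simp add: card_nsets)

lemma total_weight_mono: "finite Y \<Longrightarrow> X \<subseteq> Y \<Longrightarrow> total_weight x X \<le> total_weight x Y"
  unfolding total_weight_def by (intro sum_mono2) (auto intro: nsets_mono dest: nsets_mono)

lemma total_weight_singleton [simp]: "total_weight x {v} = 0"
proof -
  have "nsets {v} 2 = {}"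
    by (auto simp: nsets_def card_Suc_eq numeral_2_eq_2)
  then show ?thesis by (simp add: total_weight_def)
qed

lemma total_weight_empty [simp]: "total_weight x {} = 0"
  by (simp add: total_weight_def nsets_def)

lemma nsets2_Un:
  assumes "X \<inter> Y = {}"
  shows "nsets (X \<union> Y) 2 = nsets X 2 \<union> nsets Y 2 \<union> (\<lambda>(a,b). {a,b}) ` (X \<times> Y)"
  unfolding nsets_disjoint_2[OF assms] by auto

lemma total_weight_Un:
  assumes "finite X" "finite Y" "X \<inter> Y = {}"
  shows "total_weight x (X \<union> Y) =
    total_weight x X + total_weight x Y + (\<Sum>a\<in>X. \<Sum>b\<in>Y. x {a,b})"
proof -
  let ?C = "(\<lambda>(a,b). {a,b}) ` (X \<times> Y)"
  have inj: "inj_on (\<lambda>(a,b). {a,b}) (X \<times> Y)"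
    using assms(3) by (auto simp: inj_on_def doubleton_eq_iff)
  have d1: "nsets X 2 \<inter> nsets Y 2 = {}"
    using assms(3) by (auto simp: nsets_2_eq)
  have d2: "(nsets X 2 \<union> nsets Y 2) \<inter> ?C = {}"
    using assms(3) by (auto simp: nsets_2_eq doubleton_eq_iff)
  have "total_weight x (X \<union> Y) = sum x (nsets X 2 \<union> nsets Y 2) + sum x ?C"
    unfolding total_weight_def nsets2_Un[OF assms(3)] using assms d2
    by (intro sum.union_disjoint) auto
  also have "sum x (nsets X 2 \<union> nsets Y 2) = sum x (nsets X 2) + sum x (nsets Y 2)"
    using assms d1 by (intro sum.union_disjoint) auto
  also have "sum x ?C = (\<Sum>(a,b)\<in>X \<times> Y. x {a,b})"
    by (subst sum.reindex[OF inj]) (simp add: case_prod_unfold)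
  also have "\<dots> = (\<Sum>a\<in>X. \<Sum>b\<in>Y. x {a,b})"
    by (simp add: sum.cartesian_product)
  finally show ?thesis by (simp add: total_weight_def)
qed

lemma total_weight_Un_ge:
  assumes "finite X" "finite Y" "X \<inter> Y = {}"
  shows "total_weight x X + total_weight x Y \<le> total_weight x (X \<union> Y)"
  using total_weight_Un[OF assms] by simp

lemma total_weight_Un_closed:
  assumes "finite X" "finite Y" "X \<inter> Y = {}" "\<And>a b. a \<in> X \<Longrightarrow> b \<in> Y \<Longrightarrow> x {a,b} = 0"
  shows "total_weight x (X \<union> Y) = total_weight x X + total_weight x Y"
  using total_weight_Un[OF assms(1-3)] assms(4) by simp

lemma total_weight_insert_ge:
  assumes "finite X" "v \<notin> X" "a \<in> X"
  shows "total_weight x X + x {a,v} \<le> total_weight x (insert v X)"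
proof -
  have "x {a,v} \<le> (\<Sum>a\<in>X. x {a,v})"
    using assms by (intro member_le_sum) auto
  then show ?thesis
    using total_weight_Un[of X "{v}" x] assms by simp
qed

text \<open>\<open>X\<close> extends inside \<open>V\<close> to exactly \<open>s\<close> vertices,
  and weight is monotone. So a budget for \<open>s\<close>-sets binds all smaller sets too.\<close>

lemma total_weight_le_if_subset_card:
  assumes "finite V" "s \<le> card V" "\<And>X. X \<subseteq> V \<Longrightarrow> card X = s \<Longrightarrow> total_weight x X \<le> k"
    and "X \<subseteq> V" "card X \<le> s"
  shows "total_weight x X \<le> k"
proof -
  obtain B where "X \<subseteq> B" "B \<subseteq> V" "card B = s"
    using exists_subset_between[OF assms(5,2,4,1)] by blast
  then show ?thesis
    using assms(3)[of B] total_weight_mono[of B X x] finite_subset[OF _ assms(1)]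
    by fastforce
qed

section \<open>Connected vertex sets and the linear bound\<close>

text \<open>Grow a set from a single vertex: while it is not all of \<open>X\<close>, an edge of
  positive weight leaves it, and adding the far end raises the weight by at least 1.\<close>

lemma connected_subset_weight:
  assumes "finite X" and conn: "\<And>Y. Y \<subset> X \<Longrightarrow> Y \<noteq> {} \<Longrightarrow> \<exists>a\<in>Y. \<exists>b\<in>X - Y. x {a,b} > 0"
    and "1 \<le> j" "j \<le> card X"
  shows "\<exists>Y\<subseteq>X. card Y = j \<and> j - 1 \<le> total_weight x Y"
  using assms(3,4)
proof (induction j rule: dec_induct)
  case base
  then obtain v where "v \<in> X" by (metis card.empty ex_in_conv not_one_le_zero)
  then show ?case by (intro exI[of _ "{v}"]) simp
next
  case (step j)
  then obtain Y where Y: "Y \<subseteq> X" "card Y = j" "j - 1 \<le> total_weight x Y" by auto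
  have "Y \<noteq> X" "Y \<noteq> {}" using Y step by auto
  with conn[of Y] Y obtain a b where ab: "a \<in> Y" "b \<in> X - Y" "x {a,b} > 0" by blast
  have fY: "finite Y" using Y(1) assms(1) finite_subset by blast
  have "total_weight x Y + x {a,b} \<le> total_weight x (insert b Y)"
    using total_weight_insert_ge[OF fY] ab by auto
  then show ?case using Y ab fY by (intro exI[of _ "insert b Y"]) auto
qed

text \<open>The budget that \<open>X\<close> leaves over. It supplies the hypothesis of the linear
  bound on the complement, with \<open>s - card X\<close> and \<open>k - total_weight x X\<close> as
  new parameters.\<close>

lemma total_weight_complement_bound:
  assumes "finite V" "X \<subseteq> V" "card X \<le> s" "Y \<subseteq> V - X" "card Y = s - card X"
    and "\<And>X. X \<subseteq> V \<Longrightarrow> card X = s \<Longrightarrow> total_weight x X \<le> k"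
  shows "total_weight x Y \<le> k - total_weight x X"
proof -
  have fin: "finite X" "finite Y" using assms finite_subset by blast+
  have disj: "X \<inter> Y = {}" and "X \<union> Y \<subseteq> V" using assms by auto
  moreover have "card (X \<union> Y) = s" using card_Un_disjoint[OF fin disj] assms by simp
  ultimately show ?thesis
    using total_weight_Un_ge[OF fin disj, of x] assms(6)[of "X \<union> Y"] by simp
qed

text \<open>Strong induction on \<open>s\<close>, applied to what remains after a dense component is
  removed. For \<open>k = s - 2\<close>, disjoint stars on \<open>s - 1\<close> vertices attain the
  bound when \<open>s - 1\<close> divides \<open>card V\<close>.\<close>

lemma linear_weight_bound:
  assumes "finite V" "s \<le> card V" "k + 2 \<le> s"
    and "\<And>X. X \<subseteq> V \<Longrightarrow> card X = s \<Longrightarrow> total_weight x X \<le> k"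
  shows "total_weight x V * (s - 1) \<le> k * card V"
  using assms
proof (induction s arbitrary: V k rule: less_induct)
  case (less s)
  note finV = less.prems(1) and sV = less.prems(2) and ks = less.prems(3)
  have small: "total_weight x X \<le> k" if "X \<subseteq> V" "card X \<le> s" for X
    using total_weight_le_if_subset_card[OF finV sV _ that] less.prems(4) by blast
  show ?case
  proof (rule ccontr)
    assume contr: "\<not> ?thesis"
    \<comment> \<open>\<open>closed\<close> sets are the unions of components of the support of
      \<open>x\<close>; \<open>dense\<close> ones exceed the claimed bound.\<close>
    define closed where "closed X \<longleftrightarrow> X \<subseteq> V \<and> (\<forall>a\<in>X. \<forall>b\<in>V - X. x {a,b} = 0)" for X
    define dense where "dense X \<longleftrightarrow> closed X \<and> k * card X < total_weight x X * (s - 1)" for X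
    have "dense V" using contr by (auto simp: dense_def closed_def)
    then obtain X where X: "dense X" and Xmin: "\<And>Y. dense Y \<Longrightarrow> card X \<le> card Y"
      using ex_has_least_nat[of dense V card] by blast
    have XV: "X \<subseteq> V" and clX: "closed X" using X by (auto simp: dense_def closed_def)
    have finX: "finite X" using XV finV finite_subset by blast
    define m a where "m = card X" and "a = total_weight x X"
    have am: "k * m < a * (s - 1)" using X by (simp add: dense_def m_def a_def)
    have "X \<noteq> {}" using am by (auto simp: a_def)
    then have m1: "1 \<le> m" using finX by (simp add: m_def Suc_le_eq card_gt_0_iff)
    \<comment> \<open>If no weight ran between two parts of \<open>X\<close>, both would be closed
      and smaller than \<open>X\<close>, hence not dense, and their two bounds would add up to a
      contradiction with the density of \<open>X\<close>.\<close>
    have conn: "\<exists>a\<in>Y. \<exists>b\<in>X - Y. x {a,b} > 0" if Y: "Y \<subset> X" "Y \<noteq> {}" for Y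
    proof (rule ccontr)
      assume "\<not> ?thesis"
      then have no: "\<And>a b. a \<in> Y \<Longrightarrow> b \<in> X - Y \<Longrightarrow> x {a,b} = 0" by auto
      have finY: "finite Y" using Y finX finite_subset by blast
      have cl: "closed Y" "closed (X - Y)"
        using no clX Y unfolding closed_def
        by (blast, metis (no_types, lifting) DiffD1 DiffD2 DiffI Diff_subset insert_commute order_trans)
      have "card Y < card X" "card (X - Y) < card X"
        using Y finX by (auto intro!: psubset_card_mono)
      then have "\<not> dense Y" "\<not> dense (X - Y)" using Xmin not_le by blast+
      then have le: "total_weight x Y * (s - 1) \<le> k * card Y"
        "total_weight x (X - Y) * (s - 1) \<le> k * card (X - Y)"
        using cl by (auto simp: dense_def)
      have "Y \<union> (X - Y) = X" using Y by auto
      then have "a = total_weight x Y + total_weight x (X - Y)"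
        using total_weight_Un_closed[of Y "X - Y" x] no finX finY by (auto simp: a_def)
      moreover have "m = card Y + card (X - Y)"
        using Y finX finY by (simp add: m_def card_Diff_subset card_mono psubset_imp_subset)
      ultimately show False using le am by (simp add: algebra_simps)
    qed
    \<comment> \<open>A connected \<open>X\<close> with \<open>s\<close> or more vertices would
      contain an \<open>s\<close>-set of weight at least \<open>s - 1\<close>, above the budget
      \<open>k\<close>.\<close>
    have "m < s"
    proof (rule ccontr)
      assume "\<not> m < s"
      then obtain Y where Y: "Y \<subseteq> X" "card Y = s" "s - 1 \<le> total_weight x Y"
        using connected_subset_weight[OF finX conn, of s] ks by (auto simp: m_def)
      then have "total_weight x Y \<le> k" using less.prems(4) XV by blast
      then show False using Y ks by linarith
    qed
    have ak: "a \<le> k" using small[OF XV] \<open>m < s\<close> by (simp add: a_def m_def)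
    have "m \<noteq> s - 1"
    proof
      assume "m = s - 1"
      then have "k < a" using am by (simp add: mult.commute)
      then show False using ak by simp
    qed
    then have ms: "m + 2 \<le> s" using \<open>m < s\<close> by simp
    \<comment> \<open>The side condition of the induction hypothesis. Its failure gives
      \<open>a \<le> k + m + 1 - s\<close>; the density of \<open>X\<close> then yields
      \<open>(s - 1 - k) * (s - 1 - m) < 0\<close>, though both factors are positive.\<close>
    have "(k - a) + 2 \<le> s - m"
    proof (rule ccontr)
      assume "\<not> ?thesis"
      then have 1: "int a + int s \<le> int k + int m + 1" using ak ms by linarith
      have "int (k * m) < int (a * (s - 1))" using am by linarith
      then have 2: "int k * int m < int a * (int s - 1)" using ks by (simp add: of_nat_diff)
      have "(int s - 1 - int k) * (int s - 1 - int m) \<ge> 0"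
        using ks ms by (intro mult_nonneg_nonneg) auto
      moreover have "int a * (int s - 1) \<le> (int k + int m + 1 - int s) * (int s - 1)"
        using 1 ks by (intro mult_right_mono) auto
      ultimately show False using 2 by (simp add: algebra_simps)
    qed
    moreover have cardD: "card (V - X) = card V - m"
      using XV finX by (simp add: card_Diff_subset m_def)
    moreover have "total_weight x Y \<le> k - a" if "Y \<subseteq> V - X" "card Y = s - m" for Y
      unfolding a_def using that \<open>m < s\<close> less.prems(4)
      by (intro total_weight_complement_bound[OF finV XV]) (auto simp: m_def)
    ultimately have IH: "total_weight x (V - X) * (s - m - 1) \<le> (k - a) * (card V - m)"
      using less.IH[of "s - m" "V - X" "k - a"] m1 ms finV sV by simp
    define b n where "b = total_weight x (V - X)" and "n = card V"
    have "total_weight x V = a + b"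
      using total_weight_Un_closed[of X "V - X" x] finX finV XV clX
      by (auto simp: a_def b_def closed_def Un_absorb1)
    with contr have "int (k * n) < int ((a + b) * (s - 1))" unfolding n_def of_nat_less_iff by simp
    then have contr': "int k * int n < (int a + int b) * (int s - 1)"
      using ks by (simp add: of_nat_diff)
    define d S where "d = int s - 1 - int m" and "S = int s - 1"
    have d: "d > 0" using ms by (simp add: d_def)
    have "int (b * (s - m - 1)) \<le> int ((k - a) * (n - m))" using IH unfolding b_def n_def of_nat_le_iff .
    then have IH': "int b * d \<le> (int k - int a) * (int n - int m)"
    proof -
      have "int (s - m - 1) = d" "int (k - a) = int k - int a" "int (n - m) = int n - int m"
        using ms ak sV by (auto simp: d_def n_def)
      then show ?thesis using \<open>int (b * (s - m - 1)) \<le> _\<close> by (simp only: of_nat_mult)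
    qed
    have am': "int k * int m \<le> int a * S"
    proof -
      have "int (k * m) \<le> int (a * (s - 1))" using am by linarith
      then show ?thesis using ks by (simp add: S_def of_nat_diff)
    qed
    \<comment> \<open>The induction hypothesis scaled by \<open>S\<close> and the density of
      \<open>X\<close> scaled by \<open>n - S\<close> add up to \<open>d\<close> times the claimed
      bound for \<open>V\<close>.\<close>
    have "S * (int b * d) \<le> S * ((int k - int a) * (int n - int m))"
      using IH' ks by (intro mult_left_mono) (auto simp: S_def)
    moreover have "int k * int m * (int n - S) \<le> int a * S * (int n - S)"
      using am' sV by (intro mult_right_mono) (auto simp: S_def n_def)
    ultimately have "(int a + int b) * S * d \<le> int k * int n * d"
      by (simp add: d_def S_def[symmetric] algebra_simps)
    moreover have "int k * int n * d < (int a + int b) * S * d"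
      using contr' d by (simp add: S_def)
    ultimately show False by simp
  qed
qed

section \<open>Girth and local sparsity\<close>

text \<open>Says that every set of at most \<open>s\<close> vertices spans a forest, which amounts
  to girth larger than \<open>s\<close>. Counting edges instead of cycles allows a direct comparison
  with the weights of small sets.\<close>

definition locally_sparse :: "nat \<Rightarrow> 'a set set \<Rightarrow> bool" where
  "locally_sparse s E \<longleftrightarrow>
     (\<forall>Z. finite Z \<and> Z \<noteq> {} \<and> card Z \<le> s \<longrightarrow> card (E \<inter> nsets Z 2) < card Z)"

section \<open>Short cycles and sets spanning at least as many edges as vertices\<close>

text \<open>Two distinct indices with the same edge would each be the cyclic successor of the other,
  which forces \<open>l\<close> to be at most 2.\<close>

lemma inj_on_cycle_edges:
  assumes "distinct vs" "length vs = l" "3 \<le> l"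
  shows "inj_on (\<lambda>i. {vs ! i, vs ! (Suc i mod l)}) {..<l}"
proof (rule inj_onI)
  fix i j assume "i \<in> {..<l}" "j \<in> {..<l}"
    and eq: "{vs ! i, vs ! (Suc i mod l)} = {vs ! j, vs ! (Suc j mod l)}"
  then have ij: "i < l" "j < l" by auto
  have l: "Suc i mod l < l" "Suc j mod l < l" using assms by auto
  show "i = j"
  proof (rule ccontr)
    assume "i \<noteq> j"
    then have "vs ! i = vs ! (Suc j mod l)" "vs ! j = vs ! (Suc i mod l)"
      using eq ij assms(1,2) by (auto simp: doubleton_eq_iff nth_eq_iff_index_eq)
    then have "i = Suc j mod l" "j = Suc i mod l"
      using ij l assms(1,2) nth_eq_iff_index_eq by metis+
    moreover have "Suc i mod l = (if Suc i = l then 0 else Suc i)"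
      "Suc j mod l = (if Suc j = l then 0 else Suc j)"
      using ij by auto
    ultimately have "i = 0 \<and> Suc j = l \<or> i = Suc j" "j = 0 \<and> Suc i = l \<or> j = Suc i"
      by metis+
    then show False using assms(3) by linarith
  qed
qed

lemma cycle_edge_in_nsets:
  assumes "distinct vs" "length vs = l" "2 \<le> l" "i < l"
  shows "{vs ! i, vs ! (Suc i mod l)} \<in> nsets (set vs) 2"
proof -
  have "i \<noteq> Suc i mod l" using assms by (auto simp: mod_Suc)
  moreover have "Suc i mod l < l" using assms by simp
  ultimately show ?thesis using assms by (auto simp: nth_eq_iff_index_eq)
qed

lemma not_locally_sparse_if_has_cycle:
  assumes "has_cycle E l" "l \<le> s"
  shows "\<not> locally_sparse s E"
proof -
  obtain vs where l: "3 \<le> l" and vs: "length vs = l" "distinct vs"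
    and E: "\<And>i. i < l \<Longrightarrow> {vs ! i, vs ! (Suc i mod l)} \<in> E"
    using assms(1) by (auto simp: has_cycle_def)
  let ?e = "\<lambda>i. {vs ! i, vs ! (Suc i mod l)}"
  have card: "card (set vs) = l" using vs by (simp add: distinct_card)
  have "?e ` {..<l} \<subseteq> E \<inter> nsets (set vs) 2"
    using E l cycle_edge_in_nsets[OF vs(2,1)] by auto
  then have "card (?e ` {..<l}) \<le> card (E \<inter> nsets (set vs) 2)"
    by (intro card_mono) auto
  moreover have "card (?e ` {..<l}) = l"
    using card_image[OF inj_on_cycle_edges[OF vs(2,1) l]] by simp
  ultimately have "\<not> card (E \<inter> nsets (set vs) 2) < card (set vs)" using card by simp
  moreover have "set vs \<noteq> {}" using vs l by auto
  ultimately show ?thesis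
    unfolding locally_sparse_def using card assms(2) by (metis List.finite_set)
qed

lemma nsets2_insert_decomp:
  assumes "v \<in> Z"
  shows "E \<inter> nsets Z 2 = (E \<inter> nsets (Z - {v}) 2) \<union> (\<lambda>a. {v,a}) ` {a \<in> Z - {v}. {v,a} \<in> E}"
proof -
  have "{v} \<inter> (Z - {v}) = {}" "Z = {v} \<union> (Z - {v})" using assms by auto
  then have "nsets Z 2 = nsets {v} 2 \<union> nsets (Z - {v}) 2 \<union> (\<Union>y\<in>Z - {v}. {{v,y}})"
    using nsets_disjoint_2[of "{v}" "Z - {v}"] by simp
  moreover have "nsets {v} 2 = {}" by (auto simp: nsets_2_eq)
  ultimately show ?thesis by auto
qed

text \<open>Induction on \<open>card Z\<close>. Deleting a vertex with at most one neighbour in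
  \<open>Z\<close> costs at most one edge. If all degrees are at least 2, an end of a longest path
  has all its neighbours on the path, one of them beyond the next vertex, and that edge closes a
  cycle.\<close>

lemma has_cycle_if_many_edges:
  assumes "finite Z" "Z \<noteq> {}" "card Z \<le> card (E \<inter> nsets Z 2)"
  shows "\<exists>l. 3 \<le> l \<and> l \<le> card Z \<and> has_cycle E l"
  using assms
proof (induction "card Z" arbitrary: Z rule: less_induct)
  case less
  note fin = less.prems(1)
  define N where "N v = {a \<in> Z - {v}. {v,a} \<in> E}" for v
  have finN: "finite (N v)" for v using fin by (simp add: N_def)
  show ?case
  proof (cases "\<exists>v\<in>Z. card (N v) \<le> 1")
    case True
    then obtain v where v: "v \<in> Z" "card (N v) \<le> 1" by blast
    have "card (E \<inter> nsets Z 2) \<le> card (E \<inter> nsets (Z - {v}) 2) + card ((\<lambda>a. {v,a}) ` N v)"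
      unfolding nsets2_insert_decomp[OF v(1)] N_def by (rule card_Un_le)
    also have "card ((\<lambda>a. {v,a}) ` N v) \<le> 1"
      using card_image_le[OF finN] v(2) order_trans by blast
    finally have le: "card Z - 1 \<le> card (E \<inter> nsets (Z - {v}) 2)" using less.prems(3) by simp
    have "Z \<noteq> {v}"
    proof
      assume "Z = {v}"
      moreover have "nsets {v} 2 = {}" by (auto simp: nsets_2_eq)
      ultimately show False using less.prems(3) by simp
    qed
    then have "Z - {v} \<noteq> {}" using v by auto
    moreover have "card (Z - {v}) < card Z" using card_Diff1_less[OF fin v(1)] .
    moreover have "card (Z - {v}) \<le> card (E \<inter> nsets (Z - {v}) 2)" using le v fin by simp
    ultimately obtain l where "3 \<le> l" "l \<le> card (Z - {v})" "has_cycle E l"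
      using less.hyps[of "Z - {v}"] fin by auto
    then show ?thesis using \<open>card (Z - {v}) < card Z\<close> by auto
  next
    case False
    then have deg: "2 \<le> card (N v)" if "v \<in> Z" for v using that by force
    define path where "path vs \<longleftrightarrow> vs \<noteq> [] \<and> distinct vs \<and> set vs \<subseteq> Z \<and>
      (\<forall>i. Suc i < length vs \<longrightarrow> {vs ! i, vs ! Suc i} \<in> E)" for vs
    obtain z where "z \<in> Z" using less.prems by auto
    then have "path [z]" by (simp add: path_def)
    moreover have "\<forall>vs. path vs \<longrightarrow> length vs < Suc (card Z)"
      using fin unfolding path_def less_Suc_eq_le by (metis card_mono distinct_card)
    ultimately obtain vs where vs: "path vs" and longest: "\<And>us. path us \<Longrightarrow> length us \<le> length vs"
      using ex_has_greatest_nat[of path "[z]" length "Suc (card Z)"] by blast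
    define v where "v = vs ! 0"
    have ne: "vs \<noteq> []" and dist: "distinct vs" and sub: "set vs \<subseteq> Z"
      using vs by (auto simp: path_def)
    have vZ: "v \<in> Z" using ne sub by (auto simp: v_def)
    have on_path: "\<exists>i<length vs. 1 \<le> i \<and> vs ! i = a" if a: "a \<in> N v" for a
    proof -
      have "a \<in> set vs"
      proof (rule ccontr)
        assume "a \<notin> set vs"
        then have "path (a # vs)"
          using vs a ne unfolding path_def N_def
          by (auto simp: v_def nth_Cons insert_commute split: nat.split)
        then show False using longest by fastforce
      qed
      then obtain i where "i < length vs" "vs ! i = a" by (auto simp: in_set_conv_nth)
      moreover have "i \<noteq> 0" using calculation a by (cases "i = 0") (auto simp: N_def v_def)
      ultimately show ?thesis by auto
    qed
    have "\<exists>j<length vs. 2 \<le> j \<and> vs ! j \<in> N v"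
    proof (rule ccontr)
      assume no: "\<not> ?thesis"
      have "N v \<subseteq> {vs ! 1}"
      proof
        fix a assume a: "a \<in> N v"
        obtain i where i: "i < length vs" "1 \<le> i" "vs ! i = a" using on_path[OF a] by blast
        then have "\<not> 2 \<le> i" using no a by blast
        then have "i = 1" using i by simp
        then show "a \<in> {vs ! 1}" using i by simp
      qed
      then have "card (N v) \<le> card {vs ! 1}" by (intro card_mono) auto
      then show False using deg[OF vZ] by simp
    qed
    then obtain j where j: "j < length vs" "2 \<le> j" "vs ! j \<in> N v" by blast
    \<comment> \<open>The segment from \<open>v\<close> to its neighbour \<open>vs ! j\<close>,
      closed by the edge between them; \<open>2 \<le> j\<close> makes its length at least 3.\<close>
    define us where "us = take (Suc j) vs"
    have len: "length us = Suc j" using j by (simp add: us_def)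
    have "{us ! i, us ! (Suc i mod Suc j)} \<in> E" if "i < Suc j" for i
    proof (cases "i = j")
      case True
      then show ?thesis using j by (auto simp: us_def N_def v_def insert_commute)
    next
      case False
      then show ?thesis using that vs j by (auto simp: us_def path_def)
    qed
    then have "has_cycle E (Suc j)"
      unfolding has_cycle_def using j len dist by (intro conjI exI[of _ us]) (auto simp: us_def)
    moreover have "Suc j \<le> card Z"
      using j sub dist fin by (metis Suc_leI card_mono distinct_card order_trans)
    ultimately show ?thesis using j by (intro exI[of _ "Suc j"]) auto
  qed
qed

lemma locally_sparse_iff_no_short_cycle:
  "locally_sparse s E \<longleftrightarrow> (\<forall>l\<in>{3..s}. \<not> has_cycle E l)"
proof
  assume "locally_sparse s E"
  then show "\<forall>l\<in>{3..s}. \<not> has_cycle E l"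
    by (meson atLeastAtMost_iff not_locally_sparse_if_has_cycle)
next
  assume no: "\<forall>l\<in>{3..s}. \<not> has_cycle E l"
  show "locally_sparse s E"
    unfolding locally_sparse_def
  proof (intro allI impI, rule ccontr)
    fix Z :: "'a set" assume Z: "finite Z \<and> Z \<noteq> {} \<and> card Z \<le> s"
      and "\<not> card (E \<inter> nsets Z 2) < card Z"
    then obtain l where "3 \<le> l" "l \<le> card Z" "has_cycle E l"
      using has_cycle_if_many_edges[of Z E] by auto
    then show False using no Z by auto
  qed
qed

section \<open>Constructions of graphs of large girth\<close>

text \<open>All vertices of \<open>X\<close> become leaves at \<open>a\<close>. A small
  \<open>Z\<close> contains at most one new edge for each of its vertices in \<open>X\<close>, and
  fewer old edges than it has other vertices.\<close>

lemma locally_sparse_add_pendants: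
  assumes E: "locally_sparse s E" "E \<subseteq> nsets W 2" and fin: "finite W" "finite X"
    and "X \<inter> W = {}" "a \<in> W"
  shows "\<exists>F \<subseteq> nsets (X \<union> W) 2. locally_sparse s F \<and> card F = card X + card E"
proof -
  let ?P = "(\<lambda>v. {v,a}) ` X"
  have aX: "a \<notin> X" using assms by auto
  have finE: "finite E" using E fin finite_subset by (metis finite_nsets2)
  have "?P \<inter> E = {}" using E(2) assms by (fastforce simp: nsets_2_eq doubleton_eq_iff)
  moreover have "inj_on (\<lambda>v. {v,a}) X" by (auto simp: inj_on_def doubleton_eq_iff)
  ultimately have "card (?P \<union> E) = card X + card E"
    using fin finE by (subst card_Un_disjoint) (auto simp: card_image)
  moreover have "?P \<union> E \<subseteq> nsets (X \<union> W) 2"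
    using E(2) assms(6) aX nsets_mono[of W "X \<union> W" 2] by auto
  moreover have "locally_sparse s (?P \<union> E)"
    unfolding locally_sparse_def
  proof (intro allI impI)
    fix Z :: "'a set" assume Z: "finite Z \<and> Z \<noteq> {} \<and> card Z \<le> s"
    have "(?P \<union> E) \<inter> nsets Z 2 \<subseteq>
        (\<lambda>v. {v,a}) ` {v \<in> Z \<inter> X. a \<in> Z} \<union> (E \<inter> nsets (Z - X) 2)" (is "_ \<subseteq> ?I \<union> ?J")
    proof
      fix e assume e: "e \<in> (?P \<union> E) \<inter> nsets Z 2"
      show "e \<in> ?I \<union> ?J"
      proof (cases "e \<in> E")
        case True
        then have "e \<subseteq> W" using E(2) by (auto simp: nsets_def)
        then show ?thesis using True e assms(5) by (auto simp: nsets_def)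
      qed (use e in auto)
    qed
    then have "card ((?P \<union> E) \<inter> nsets Z 2) \<le> card (?I \<union> ?J)"
      using Z by (intro card_mono) auto
    also have "\<dots> \<le> card ?I + card ?J" by (rule card_Un_le)
    also have "card ?I \<le> card {v \<in> Z \<inter> X. a \<in> Z}" using Z by (intro card_image_le) auto
    \<comment> \<open>\<open>locally_sparse\<close> is silent on the empty set, so \<open>Z\<close>
      inside \<open>X\<close> is treated apart: then \<open>a\<close> is not in \<open>Z\<close> and
      no edge remains.\<close>
    also have "card {v \<in> Z \<inter> X. a \<in> Z} + card ?J < card Z"
    proof (cases "Z - X = {}")
      case True
      then have "a \<notin> Z" using aX by auto
      moreover have "nsets ({} :: 'a set) 2 = {}" by (auto simp: nsets_2_eq)
      ultimately show ?thesis using Z unfolding True by (simp add: card_gt_0_iff)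
    next
      case False
      then have "card ?J < card (Z - X)"
        using E(1) Z card_mono[of Z "Z - X"] unfolding locally_sparse_def
        by (metis Diff_subset finite_Diff order_trans)
      moreover have "card {v \<in> Z \<inter> X. a \<in> Z} \<le> card (Z \<inter> X)" using Z by (intro card_mono) auto
      moreover have "card (Z \<inter> X) + card (Z - X) = card Z"
        using Z by (metis card_Diff_subset_Int card_mono finite_Int inf_le1 le_add_diff_inverse)
      ultimately show ?thesis by linarith
    qed
    finally show "card ((?P \<union> E) \<inter> nsets Z 2) < card Z" by simp
  qed
  ultimately show ?thesis by blast
qed

text \<open>Leaves attached to an edgeless vertex. Being a tree, the star serves every
  \<open>s\<close>, and so settles all total weights below \<open>card V\<close>.\<close>

lemma locally_sparse_star:
  assumes "finite V" "V \<noteq> {}"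
  shows "\<exists>E \<subseteq> nsets V 2. locally_sparse s E \<and> card E = card V - 1"
proof -
  obtain a where a: "a \<in> V" using assms by auto
  have "locally_sparse s ({} :: 'a set set)" by (auto simp: locally_sparse_def card_gt_0_iff)
  then show ?thesis
    using locally_sparse_add_pendants[of s "{}" "{a}" "V - {a}" a] a assms(1)
    by (auto simp: insert_absorb)
qed

text \<open>A cycle through all of \<open>V\<close>. A vertex set with as many of its edges as
  vertices is closed under the cyclic successor, hence empty or all of \<open>V\<close>, which is
  larger than \<open>s\<close>.\<close>

lemma locally_sparse_cycle:
  assumes "finite V" "s < card V" "3 \<le> card V"
  shows "\<exists>E \<subseteq> nsets V 2. locally_sparse s E \<and> card E = card V"
proof -
  obtain vs where vs: "set vs = V" "distinct vs" using finite_distinct_list[OF assms(1)] by blast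
  define l where "l = length vs"
  have l: "l = card V" "3 \<le> l" using vs assms by (auto simp: l_def distinct_card)
  let ?e = "\<lambda>i. {vs ! i, vs ! (Suc i mod l)}"
  have "?e ` {..<l} \<subseteq> nsets V 2"
    using cycle_edge_in_nsets[OF vs(2) l_def[symmetric]] vs(1) l(2) by auto
  moreover have "card (?e ` {..<l}) = card V"
    using card_image[OF inj_on_cycle_edges[OF vs(2) _ l(2)]] l by (simp add: l_def)
  moreover have "locally_sparse s (?e ` {..<l})"
    unfolding locally_sparse_def
  proof (intro allI impI)
    fix Z :: "'a set" assume Z: "finite Z \<and> Z \<noteq> {} \<and> card Z \<le> s"
    define J where "J = {i. i < l \<and> vs ! i \<in> Z}"
    define I where "I = {i \<in> J. Suc i mod l \<in> J}"
    have "inj_on (nth vs) J" using vs by (auto simp: inj_on_def J_def l_def nth_eq_iff_index_eq)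
    then have cardJ: "card J \<le> card Z"
      using Z by (intro card_inj_on_le[of "nth vs"]) (auto simp: J_def)
    have "?e ` {..<l} \<inter> nsets Z 2 \<subseteq> ?e ` I"
      using l by (auto simp: I_def J_def)
    then have "card (?e ` {..<l} \<inter> nsets Z 2) \<le> card (?e ` I)"
      by (intro card_mono) (auto simp: I_def J_def)
    also have "\<dots> \<le> card I" by (intro card_image_le) (auto simp: I_def J_def)
    finally have le: "card (?e ` {..<l} \<inter> nsets Z 2) \<le> card I" .
    show "card (?e ` {..<l} \<inter> nsets Z 2) < card Z"
    proof (cases "I = J")
      case False
      then have "I \<subset> J" by (auto simp: I_def)
      then have "card I < card J" by (intro psubset_card_mono) (auto simp: J_def)
      then show ?thesis using le cardJ by linarith
    next
      case True
      then have succ: "Suc i mod l \<in> J" if "i \<in> J" for i using that by (auto simp: I_def)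
      have "J = {}"
      proof (rule ccontr)
        assume "J \<noteq> {}"
        then obtain i where i: "i \<in> J" by auto
        then have il: "i < l" by (simp add: J_def)
        have shift: "(i + k) mod l \<in> J" for k
        proof (induction k)
          case 0
          then show ?case using i il by simp
        next
          case (Suc k)
          then show ?case using succ[OF Suc] by (simp add: mod_Suc_eq)
        qed
        have "{..<l} \<subseteq> J"
        proof
          fix j assume "j \<in> {..<l}"
          \<comment> \<open>\<open>l - i + j\<close> successor steps lead from \<open>i\<close>
            around the cycle to \<open>j\<close>.\<close>
          then have "(i + (l - i + j)) mod l = j" using il by simp
          then show "j \<in> J" using shift[of "l - i + j"] by simp
        qed
        then have "card {..<l} \<le> card J" by (intro card_mono) (auto simp: J_def)
        then show False using cardJ Z assms(2) l by simp
      qed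
      then have "I = {}" using True by simp
      then show ?thesis using le Z by (simp add: card_gt_0_iff)
    qed
  qed
  ultimately show ?thesis by blast
qed

text \<open>Only totals are compared, not single edges. Induction on \<open>card V\<close>,
  according to whether the weight of some small set exceeds its size, merely reaches it, or never
  does.\<close>

lemma locally_sparse_dominating_weight:
  assumes "2 \<le> s" "finite V" "s \<le> card V"
    and "\<And>X. X \<subseteq> V \<Longrightarrow> card X = s \<Longrightarrow> total_weight x X \<le> s - 1"
  shows "\<exists>E \<subseteq> nsets V 2. locally_sparse s E \<and> total_weight x V \<le> card E"
  using assms(2-)
proof (induction "card V" arbitrary: V rule: less_induct)
  case less
  note finV = less.prems(1) and sV = less.prems(2)
  have small: "total_weight x X \<le> s - 1" if "X \<subseteq> V" "card X \<le> s" for X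
    using total_weight_le_if_subset_card[OF finV sV _ that] less.prems(3) by blast
  have star: ?case if "total_weight x V \<le> card V - 1"
  proof -
    have "V \<noteq> {}" using sV assms(1) by auto
    then show ?thesis using locally_sparse_star[OF finV] that by metis
  qed
  \<comment> \<open>Adding a neighbour raises the weight at least as much as the size, so a largest \<open>X\<close> with at
    most \<open>s\<close> vertices and \<open>card X + t \<le> total_weight x X\<close> is a union of components.\<close>
  have max_closed: "\<exists>X\<subseteq>V. X \<noteq> {} \<and> card X < s \<and> card X + t \<le> total_weight x X \<and>
      (\<forall>a\<in>X. \<forall>b\<in>V - X. x {a,b} = 0)"
    if Z: "Z \<subseteq> V" "Z \<noteq> {}" "card Z \<le> s" "card Z + t \<le> total_weight x Z" for Z t
  proof -
    define P where "P X \<longleftrightarrow> X \<subseteq> V \<and> card X \<le> s \<and> card X + t \<le> total_weight x X" for X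
    have "P Z" using Z by (simp add: P_def)
    moreover have "\<forall>Y. P Y \<longrightarrow> card Y < Suc s" by (simp add: P_def)
    ultimately obtain X where X: "P X" and max: "\<And>Y. P Y \<Longrightarrow> card Y \<le> card X"
      using ex_has_greatest_nat[of P Z card "Suc s"] by blast
    have finX: "finite X" using X finV finite_subset by (auto simp: P_def)
    have "0 < card Z" using Z finV finite_subset by (auto simp: card_gt_0_iff)
    then have "X \<noteq> {}" using max[OF \<open>P Z\<close>] by auto
    \<comment> \<open>On \<open>s\<close> vertices the weight is at most \<open>s - 1\<close>, so
      \<open>X\<close> has room for one more vertex.\<close>
    moreover have "total_weight x X \<le> s - 1" using X small by (auto simp: P_def)
    then have lt: "card X < s" using X assms(1) by (auto simp: P_def)
    moreover have "x {a,b} = 0" if ab: "a \<in> X" "b \<in> V - X" for a b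
    proof (rule ccontr)
      assume "x {a,b} \<noteq> 0"
      then have "P (insert b X)"
        using total_weight_insert_ge[OF finX, of b a x] ab X lt finX by (auto simp: P_def)
      then show False using max[of "insert b X"] ab finX by auto
    qed
    ultimately show ?thesis using X by (intro exI[of _ X]) (auto simp: P_def)
  qed
  have split: "total_weight x V = total_weight x X + total_weight x (V - X)"
    if "X \<subseteq> V" "\<forall>a\<in>X. \<forall>b\<in>V - X. x {a,b} = 0" for X
    using total_weight_Un_closed[of X "V - X" x] that finV finite_subset[OF that(1) finV]
    by (auto simp: Un_absorb1)
  have cardD: "card (V - X) = card V - card X" "card X \<le> card V" if "X \<subseteq> V" for X
    using that finV finite_subset[OF that] by (auto simp: card_Diff_subset card_mono)
  \<comment> \<open>The first two cases are shaped for \<open>max_closed\<close> with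
    \<open>t = 1\<close> and \<open>t = 0\<close>.\<close>
  consider (overfull) Z where "Z \<subseteq> V" "Z \<noteq> {}" "card Z \<le> s" "card Z + 1 \<le> total_weight x Z"
    | (full) Z where "Z \<subseteq> V" "Z \<noteq> {}" "card Z \<le> s" "card Z + 0 \<le> total_weight x Z"
        "\<And>Y. Y \<subseteq> V \<Longrightarrow> Y \<noteq> {} \<Longrightarrow> card Y \<le> s \<Longrightarrow> total_weight x Y \<le> card Y"
    | (sparse) "\<And>Z. Z \<subseteq> V \<Longrightarrow> Z \<noteq> {} \<Longrightarrow> card Z \<le> s \<Longrightarrow> total_weight x Z < card Z"
    by (metis Suc_eq_plus1 add.right_neutral not_less not_less_eq_eq)
  then show ?case
  proof cases
    case overfull
    obtain X where X: "X \<subseteq> V" "X \<noteq> {}" "card X < s" "card X + 1 \<le> total_weight x X"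
      "\<forall>a\<in>X. \<forall>b\<in>V - X. x {a,b} = 0"
      using max_closed[OF overfull] by blast
    define m a n b where "m = card X" and "a = total_weight x X" and "n = card V"
      and "b = total_weight x (V - X)"
    have a: "a \<le> s - 1" using small X by (simp add: a_def)
    have ma: "m + 1 \<le> a" using X by (simp add: m_def a_def)
    have finX: "finite X" using X finV finite_subset by blast
    \<comment> \<open>The linear bound with parameters \<open>s - m\<close> and
      \<open>s - 1 - a\<close> requires \<open>m + 1 \<le> a\<close>, which is exactly
      overfullness.\<close>
    have "b * (s - m - 1) \<le> (s - 1 - a) * (n - m)"
    proof -
      have "total_weight x Y \<le> s - 1 - a" if "Y \<subseteq> V - X" "card Y = s - m" for Y
        unfolding a_def using that X(3) less.prems(3)
        by (intro total_weight_complement_bound[OF finV X(1)]) (auto simp: m_def)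
      then show ?thesis
        using linear_weight_bound[of "V - X" "s - m" "s - 1 - a" x] finV sV X cardD[OF X(1)] ma a
        by (simp add: b_def m_def n_def)
    qed
    then have "int (b * (s - m - 1)) \<le> int ((s - 1 - a) * (n - m))" unfolding of_nat_le_iff .
    moreover have "int (s - m - 1) = int s - int m - 1" "int (s - 1 - a) = int s - 1 - int a"
      "int (n - m) = int n - int m"
      using ma a sV X(3) by (auto simp: m_def n_def)
    ultimately have le: "int b * (int s - int m - 1) \<le> (int s - 1 - int a) * (int n - int m)"
      by (simp only: of_nat_mult)
    \<comment> \<open>A total of at least \<open>n\<close> turns the bound on \<open>b\<close> into
      \<open>(a - m) * (n - s + 1) \<le> 0\<close>, though both factors are positive.\<close>
    have "int a + int b < int n"
    proof (rule ccontr)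
      assume "\<not> ?thesis"
      then have "(int n - int a) * (int s - int m - 1) \<le> int b * (int s - int m - 1)"
        using ma a X(3) by (intro mult_right_mono) (auto simp: m_def)
      with le have "(int a - int m) * (int n - int s + 1) \<le> 0"
        by (simp add: algebra_simps)
      moreover have "0 < (int a - int m) * (int n - int s + 1)"
        using ma sV by (intro mult_pos_pos) (auto simp: n_def)
      ultimately show False by simp
    qed
    then show ?thesis using split[OF X(1,5)] by (intro star) (simp add: a_def b_def n_def)
  next
    case full
    obtain X where X: "X \<subseteq> V" "X \<noteq> {}" "card X < s"
      "\<forall>a\<in>X. \<forall>b\<in>V - X. x {a,b} = 0"
      using max_closed[OF full(1-4)] by blast
    have wX: "total_weight x X \<le> card X" using full(5) X by simp
    have finX: "finite X" using X finV finite_subset by blast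
    have X0: "0 < card X" using X finX by (simp add: card_gt_0_iff)
    show ?thesis
    proof (cases "s \<le> card (V - X)")
      case True
      have "card (V - X) < card V" using cardD[OF X(1)] X0 by simp
      moreover have "total_weight x Y \<le> s - 1" if "Y \<subseteq> V - X" "card Y = s" for Y
        using that less.prems(3)[of Y] by auto
      ultimately obtain E where E: "E \<subseteq> nsets (V - X) 2" "locally_sparse s E"
        "total_weight x (V - X) \<le> card E"
        using less.hyps[of "V - X"] finV True by auto
      have "V - X \<noteq> {}"
        using True assms(1) by (metis card.empty le_zero_eq zero_neq_numeral order_trans)
      then obtain c where "c \<in> V - X" by auto
      then obtain F where "F \<subseteq> nsets (X \<union> (V - X)) 2" "locally_sparse s F"
        "card F = card X + card E"
        using locally_sparse_add_pendants[OF E(2,1), of X c] finV finX by auto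
      moreover have "X \<union> (V - X) = V" using X by auto
      ultimately show ?thesis using split[OF X(1,4)] wX E(3) by (intro exI[of _ F]) auto
    next
      case False
      \<comment> \<open>Both sides now have fewer than \<open>s\<close> vertices and weigh at most
        their size, so a cycle through \<open>V\<close> suffices if \<open>card V\<close> exceeds
        \<open>s\<close>. For \<open>card V = s\<close> that cycle is too short, but the hypothesis
        on \<open>V\<close> itself leaves room for a star.\<close>
      have "V \<noteq> X" using X sV by auto
      then have "total_weight x (V - X) \<le> card (V - X)" using full(5)[of "V - X"] X(1) False by auto
      then have le: "total_weight x V \<le> card V" using split[OF X(1,4)] wX cardD[OF X(1)] by simp
      show ?thesis
      proof (cases "card V = s")
        case True
        then show ?thesis using less.prems(3)[of V] by (intro star) simp
      next
        case False
        then obtain E where "E \<subseteq> nsets V 2" "locally_sparse s E" "card E = card V"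
          using locally_sparse_cycle[OF finV, of s] sV assms(1) by auto
        then show ?thesis using le by metis
      qed
    qed
  next
    case sparse
    define E where "E = {e \<in> nsets V 2. x e > 0}"
    \<comment> \<open>The two ends of an edge form a small set of weight below 2, so
      \<open>x\<close> is the indicator of \<open>E\<close>.\<close>
    have x1: "x e \<le> 1" if e: "e \<in> nsets V 2" for e
    proof -
      obtain u v where uv: "e = {u,v}" "u \<in> V" "v \<in> V" "u \<noteq> v" using nsets2_E[OF e] .
      then have "total_weight x e = x e" by (simp add: total_weight_def)
      moreover have "total_weight x e < card e" using sparse[of e] uv assms(1) by auto
      ultimately show ?thesis using uv by simp
    qed
    have card: "card (E \<inter> nsets Z 2) = total_weight x Z" if "Z \<subseteq> V" for Z
    proof -
      have Z: "nsets Z 2 \<subseteq> nsets V 2" using that by (rule nsets_mono)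
      have finZ: "finite Z" using that finV finite_subset by blast
      have "total_weight x Z = (\<Sum>e\<in>nsets Z 2. of_bool (e \<in> E))"
        unfolding total_weight_def
      proof (rule sum.cong)
        fix e assume "e \<in> nsets Z 2"
        then show "x e = of_bool (e \<in> E)" using x1[of e] Z by (auto simp: E_def)
      qed simp
      also have "\<dots> = card (E \<inter> nsets Z 2)"
        using finZ by (simp add: Int_commute)
      finally show ?thesis by simp
    qed
    have EV: "E \<subseteq> nsets V 2" by (auto simp: E_def)
    have "locally_sparse s E"
      unfolding locally_sparse_def
    proof (intro allI impI)
      fix Z :: "'a set" assume Z: "finite Z \<and> Z \<noteq> {} \<and> card Z \<le> s"
      \<comment> \<open>Local sparsity ranges over all finite sets, \<open>sparse\<close> only over
        subsets of \<open>V\<close>; vertices outside \<open>V\<close> lie on no edge of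
        \<open>E\<close>.\<close>
      have "E \<inter> nsets Z 2 = E \<inter> nsets (Z \<inter> V) 2" by (auto simp: E_def nsets_def)
      then have eq: "card (E \<inter> nsets Z 2) = total_weight x (Z \<inter> V)" using card by simp
      have le: "card (Z \<inter> V) \<le> card Z" using Z by (intro card_mono) auto
      show "card (E \<inter> nsets Z 2) < card Z"
      proof (cases "Z \<inter> V = {}")
        case True
        then show ?thesis using eq Z by (simp add: card_gt_0_iff)
      next
        case False
        then show ?thesis using eq le Z sparse[of "Z \<inter> V"] by auto
      qed
    qed
    then show ?thesis using card[of V] EV by (intro exI[of _ E]) (auto simp: Int_absorb2)
  qed
qed

section \<open>The extremal function\<close>

lemma sq_multigraph_weight_le:
  assumes "2 \<le> s" "s \<le> n" "G \<in> sq_multigraphs n s q" "e \<in> nsets {1..n} 2"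
  shows "snd G e \<le> q"
proof -
  have "e \<subseteq> {1..n}" "card e = 2" "finite e" using assms(4) by (auto simp: nsets_def)
  then obtain X where X: "e \<subseteq> X" "X \<subseteq> {1..n}" "card X = s"
    using exists_subset_between[of e s "{1..n}"] assms by auto
  then have X': "X \<in> nsets {1..n} s" using finite_subset by (auto simp: nsets_def)
  have "e \<in> nsets X 2" using X \<open>card e = 2\<close> \<open>finite e\<close> by (auto simp: nsets_def)
  moreover have "finite (nsets X 2)" using X finite_subset by (intro finite_nsets2) blast
  ultimately have "snd G e \<le> edge_sum G X" unfolding edge_sum_def by (intro member_le_sum) auto
  also have "\<dots> \<le> q" using assms(3) X' by (auto simp: sq_multigraphs_def)
  finally show ?thesis .
qed

lemma edge_prod_le_power:
  assumes "2 \<le> s" "s \<le> n" "G \<in> sq_multigraphs n s q"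
  shows "edge_prod G \<le> q ^ (n choose 2)"
proof -
  have fst: "fst G = {1..n}" using assms by (auto simp: sq_multigraphs_def)
  have "edge_prod G \<le> (\<Prod>e\<in>nsets {1..n} 2. q)"
    unfolding edge_prod_def fst using sq_multigraph_weight_le[OF assms] by (intro prod_mono) auto
  then show ?thesis by (simp add: card_nsets2)
qed

lemma finite_edge_prods:
  assumes "2 \<le> s" "s \<le> n"
  shows "finite (edge_prod ` sq_multigraphs n s q)"
proof (rule finite_subset)
  show "edge_prod ` sq_multigraphs n s q \<subseteq> {..q ^ (n choose 2)}"
    using edge_prod_le_power[OF assms] by blast
qed simp

text \<open>The all-zero multigraph lies in the family for every \<open>q\<close>, and the products
  are bounded, so the maximum is over a finite nonempty set.\<close>

lemma ex_Pi_attained: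
  assumes "2 \<le> s" "s \<le> n"
  shows "\<exists>G\<in>sq_multigraphs n s q. ex_Pi n s q = edge_prod G"
proof -
  have "edge_sum ({1..n}, \<lambda>e\<in>nsets {1..n} 2. 0) X = 0" if "X \<in> nsets {1..n} s" for X
  proof -
    have "nsets X 2 \<subseteq> nsets {1..n} 2" using that by (intro nsets_mono) (auto simp: nsets_def)
    then show ?thesis unfolding edge_sum_def snd_conv by (intro sum.neutral) auto
  qed
  then have "({1..n}, \<lambda>e\<in>nsets {1..n} 2. 0) \<in> sq_multigraphs n s q"
    by (auto simp: sq_multigraphs_def multigraph_def)
  then have "edge_prod ` sq_multigraphs n s q \<noteq> {}" by blast
  from Max_in[OF finite_edge_prods[OF assms] this] show ?thesis
    by (auto simp: ex_Pi_def)
qed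

lemma edge_prod_le_ex_Pi:
  assumes "2 \<le> s" "s \<le> n" "G \<in> sq_multigraphs n s q"
  shows "edge_prod G \<le> ex_Pi n s q"
  unfolding ex_Pi_def using assms(3) by (intro Max_ge finite_edge_prods[OF assms(1,2)]) blast

text \<open>Reduces upper bounds to excess functions. A maximiser with a zero weight has product 0;
  otherwise \<open>x\<close> is the weight minus 1 and each \<open>s\<close>-set loses exactly
  \<open>s choose 2\<close>.\<close>

lemma ex_Pi_le:
  assumes "2 \<le> s" "s \<le> n"
    and bound: "\<And>x. (\<And>X. X \<subseteq> {1..n} \<Longrightarrow> card X = s \<Longrightarrow> total_weight x X + (s choose 2) \<le> q) \<Longrightarrow>
      (\<Prod>e\<in>nsets {1..n} 2. Suc (x e)) \<le> B"
  shows "ex_Pi n s q \<le> B"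
proof -
  obtain G where G: "G \<in> sq_multigraphs n s q" "ex_Pi n s q = edge_prod G"
    using ex_Pi_attained[OF assms(1,2)] by blast
  have fst: "fst G = {1..n}" using G by (auto simp: sq_multigraphs_def)
  show ?thesis
  proof (cases "\<exists>e\<in>nsets {1..n} 2. snd G e = 0")
    case True
    then have "edge_prod G = 0" by (auto simp: edge_prod_def fst)
    then show ?thesis using G by simp
  next
    case False
    then have pos: "Suc (snd G e - 1) = snd G e" if "e \<in> nsets {1..n} 2" for e
      using that by force
    define x where "x e = snd G e - 1" for e
    have "total_weight x X + (s choose 2) \<le> q" if X: "X \<subseteq> {1..n}" "card X = s" for X
    proof -
      have fin: "finite X" using X finite_subset by blast
      have sub: "nsets X 2 \<subseteq> nsets {1..n} 2" using X by (intro nsets_mono)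
      have "edge_sum G X = (\<Sum>e\<in>nsets X 2. x e + 1)"
        unfolding edge_sum_def x_def using sub pos by (intro sum.cong) auto
      also have "\<dots> = total_weight x X + (s choose 2)"
        unfolding sum.distrib total_weight_def using fin X by (simp add: card_nsets2)
      finally have "edge_sum G X = total_weight x X + (s choose 2)" .
      moreover have "X \<in> nsets {1..n} s" using X fin by (simp add: nsets_def)
      ultimately show ?thesis using G(1) unfolding sq_multigraphs_def by force
    qed
    then have "(\<Prod>e\<in>nsets {1..n} 2. Suc (x e)) \<le> B" by (rule bound)
    also have "(\<Prod>e\<in>nsets {1..n} 2. Suc (x e)) = edge_prod G"
      unfolding edge_prod_def fst x_def using pos by (intro prod.cong) auto
    finally show ?thesis using G by simp
  qed
qed

lemma prod_Suc_le_power2: "(\<Prod>e\<in>A. Suc (x e)) \<le> 2 ^ (\<Sum>e\<in>A. x e)"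
proof -
  have "(\<Prod>e\<in>A. Suc (x e)) \<le> (\<Prod>e\<in>A. 2 ^ x e)"
    by (intro prod_mono) (auto simp: Suc_le_eq)
  then show ?thesis by (simp add: power_sum)
qed

lemma ex_Pi_le_power2:
  assumes "2 \<le> s" "s \<le> n"
    and bound: "\<And>x. (\<And>X. X \<subseteq> {1..n} \<Longrightarrow> card X = s \<Longrightarrow> total_weight x X + (s choose 2) \<le> q) \<Longrightarrow>
      total_weight x {1..n} \<le> t"
  shows "ex_Pi n s q \<le> 2 ^ t"
proof (rule ex_Pi_le[OF assms(1,2)])
  fix x assume "\<And>X. X \<subseteq> {1..n} \<Longrightarrow> card X = s \<Longrightarrow> total_weight x X + (s choose 2) \<le> q"
  then have "total_weight x {1..n} \<le> t" by (rule bound)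
  then have "(2::nat) ^ (\<Sum>e\<in>nsets {1..n} 2. x e) \<le> 2 ^ t"
    unfolding total_weight_def by (intro power_increasing) auto
  then show "(\<Prod>e\<in>nsets {1..n} 2. Suc (x e)) \<le> 2 ^ t"
    using prod_Suc_le_power2 order_trans by blast
qed

text \<open>The witness has weight 2 on \<open>E\<close> and 1 on all other pairs.\<close>

lemma ex_Pi_ge_power2_card:
  assumes "2 \<le> s" "s \<le> n" "E \<subseteq> nsets {1..n} 2"
    and "\<And>X. X \<subseteq> {1..n} \<Longrightarrow> card X = s \<Longrightarrow> card (E \<inter> nsets X 2) + (s choose 2) \<le> q"
  shows "2 ^ card E \<le> ex_Pi n s q"
proof -
  define G :: "nat multigraph" where
    "G = ({1..n}, \<lambda>e\<in>nsets {1..n} 2. if e \<in> E then 2 else 1)"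
  have "edge_sum G X \<le> q" if X: "X \<in> nsets {1..n} s" for X
  proof -
    have X': "X \<subseteq> {1..n}" "card X = s" "finite X" using X by (auto simp: nsets_def)
    then have sub: "nsets X 2 \<subseteq> nsets {1..n} 2" by (intro nsets_mono)
    have "edge_sum G X = (\<Sum>e\<in>nsets X 2. of_bool (e \<in> E) + 1)"
      unfolding edge_sum_def G_def using sub by (intro sum.cong) auto
    also have "\<dots> = card (E \<inter> nsets X 2) + (s choose 2)"
      unfolding sum.distrib using X' by (simp add: card_nsets2 Int_commute)
    finally show ?thesis using assms(4) X' by simp
  qed
  then have "G \<in> sq_multigraphs n s q"
    by (auto simp: sq_multigraphs_def multigraph_def G_def)
  moreover have "edge_prod G = 2 ^ card E"
  proof -
    have "edge_prod G = (\<Prod>e\<in>nsets {1..n} 2. if e \<in> E then 2 else 1)"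
      unfolding edge_prod_def G_def by (intro prod.cong) auto
    also have "\<dots> = (\<Prod>e\<in>nsets {1..n} 2 \<inter> E. 2)"
      by (subst prod.inter_restrict) auto
    also have "\<dots> = 2 ^ card E" using assms(3) by (simp add: Int_absorb1)
    finally show ?thesis .
  qed
  ultimately show ?thesis using edge_prod_le_ex_Pi[OF assms(1,2)] by fastforce
qed

text \<open>The edge \<open>{i, p i}\<close> is determined by its larger end \<open>i\<close>, so
  edges, also those inside \<open>X\<close>, can be counted as numbers.\<close>

lemma ex_Pi_ge_parent_edges:
  fixes p :: "nat \<Rightarrow> nat"
  assumes "2 \<le> s" "s \<le> n" and A: "A \<subseteq> {1..n}" "\<And>i. i \<in> A \<Longrightarrow> 1 \<le> p i \<and> p i < i"
    and "\<And>X. X \<subseteq> {1..n} \<Longrightarrow> card X = s \<Longrightarrow> card {i \<in> A \<inter> X. p i \<in> X} + (s choose 2) \<le> q"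
  shows "2 ^ card A \<le> ex_Pi n s q"
proof -
  let ?E = "(\<lambda>i. {i, p i}) ` A"
  have "inj_on (\<lambda>i. {i, p i}) A"
    using A(2) by (auto simp: inj_on_def doubleton_eq_iff) (metis less_asym)
  then have "card ?E = card A" by (rule card_image)
  moreover have "?E \<subseteq> nsets {1..n} 2" using A by fastforce
  moreover have "card (?E \<inter> nsets X 2) + (s choose 2) \<le> q" if X: "X \<subseteq> {1..n}" "card X = s" for X
  proof -
    have fin: "finite {i \<in> A \<inter> X. p i \<in> X}" using X finite_subset by fastforce
    have "?E \<inter> nsets X 2 \<subseteq> (\<lambda>i. {i, p i}) ` {i \<in> A \<inter> X. p i \<in> X}" by auto
    then have "card (?E \<inter> nsets X 2) \<le> card ((\<lambda>i. {i, p i}) ` {i \<in> A \<inter> X. p i \<in> X})"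
      using fin by (intro card_mono) auto
    also have "\<dots> \<le> card {i \<in> A \<inter> X. p i \<in> X}" using fin by (rule card_image_le)
    finally show ?thesis using assms(5)[OF X] by linarith
  qed
  ultimately show ?thesis using ex_Pi_ge_power2_card[OF assms(1,2), of ?E q] by simp
qed

lemma ex_Pi_ge_1:
  assumes "2 \<le> s" "s \<le> n" "s choose 2 \<le> q"
  shows "1 \<le> ex_Pi n s q"
proof -
  have "2 ^ card ({} :: nat set set) \<le> ex_Pi n s q"
    by (rule ex_Pi_ge_power2_card[OF assms(1,2)]) (simp_all add: assms(3))
  then show ?thesis by simp
qed

section \<open>Budgets below half of \<open>s\<close>\<close>

text \<open>Greedy choice: while the sum over \<open>F\<close> falls short of the sum over
  \<open>A\<close>, some element outside \<open>F\<close> has positive value and gains at least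
  1.\<close>

lemma ex_subset_sum_ge:
  fixes x :: "'a \<Rightarrow> nat"
  assumes "finite A" "m \<le> sum x A"
  shows "\<exists>F\<subseteq>A. card F \<le> m \<and> m \<le> sum x F"
  using assms(2)
proof (induction m)
  case 0
  then show ?case by (intro exI[of _ "{}"]) auto
next
  case (Suc m)
  then obtain F where F: "F \<subseteq> A" "card F \<le> m" "m \<le> sum x F" by auto
  show ?case
  proof (cases "Suc m \<le> sum x F")
    case True
    then show ?thesis using F by (intro exI[of _ F]) auto
  next
    case False
    have finF: "finite F" using F assms(1) finite_subset by blast
    have "sum x A = sum x F + sum x (A - F)"
      using F assms(1) by (simp add: sum.subset_diff add.commute)
    then have "sum x (A - F) \<noteq> 0" using False Suc.prems by linarith
    then obtain e where "e \<in> A - F" "x e \<noteq> 0" by (meson sum.neutral)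
    then show ?thesis using F finF by (intro exI[of _ "insert e F"]) auto
  qed
qed

text \<open>\<open>k + 1\<close> edges cover at most \<open>2 (k + 1) \<le> s\<close> vertices.\<close>

lemma total_weight_le_if_lt_half:
  assumes "finite V" "s \<le> card V" "k < s div 2"
    and "\<And>X. X \<subseteq> V \<Longrightarrow> card X = s \<Longrightarrow> total_weight x X \<le> k"
  shows "total_weight x V \<le> k"
proof (rule ccontr)
  assume "\<not> ?thesis"
  then obtain F where F: "F \<subseteq> nsets V 2" "card F \<le> Suc k" "Suc k \<le> sum x F"
    using ex_subset_sum_ge[of "nsets V 2" "Suc k" x] assms(1) by (auto simp: total_weight_def)
  have FV: "\<Union>F \<subseteq> V" using F(1) by (auto simp: nsets_def)
  then have fin: "finite (\<Union>F)" using assms(1) finite_subset by blast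
  have "card (\<Union>F) \<le> sum card F" by (rule card_Union_le_sum_card)
  also have "\<dots> = (\<Sum>e\<in>F. 2)" using F(1) by (intro sum.cong) (auto simp: nsets_def)
  also have "\<dots> \<le> s" using F(2) assms(3) by simp
  finally have "total_weight x (\<Union>F) \<le> k"
    using total_weight_le_if_subset_card[OF assms(1,2) _ FV] assms(4) by blast
  moreover have "sum x F \<le> total_weight x (\<Union>F)"
    unfolding total_weight_def using fin F(1) by (intro sum_mono2) (auto simp: nsets_def)
  ultimately show False using F(3) by linarith
qed

lemma ex_Pi_eq_0:
  assumes "2 \<le> s" "s \<le> n" "q < s choose 2"
  shows "ex_Pi n s q = 0"
proof -
  have "ex_Pi n s q \<le> 0"
  proof (rule ex_Pi_le[OF assms(1,2)])
    fix x assume "\<And>X. X \<subseteq> {1..n} \<Longrightarrow> card X = s \<Longrightarrow> total_weight x X + (s choose 2) \<le> q"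
    \<comment> \<open>The set \<open>{1..s}\<close> already violates the budget, so no such
      \<open>x\<close> exists.\<close>
    from this[of "{1..s}"] assms show "(\<Prod>e\<in>nsets {1..n} 2. Suc (x e)) \<le> 0" by simp
  qed
  then show ?thesis by simp
qed

lemma ex_Pi_lt_half:
  assumes "2 \<le> s" "s \<le> n" "s choose 2 \<le> q" "q < (s choose 2) + s div 2"
  shows "ex_Pi n s q = 2 ^ (q - (s choose 2))"
proof (rule antisym)
  define k where "k = q - (s choose 2)"
  have k: "k < s div 2" "q = k + (s choose 2)" using assms by (auto simp: k_def)
  show "ex_Pi n s q \<le> 2 ^ (q - (s choose 2))"
  proof (rule ex_Pi_le_power2[OF assms(1,2)])
    fix x assume "\<And>X. X \<subseteq> {1..n} \<Longrightarrow> card X = s \<Longrightarrow> total_weight x X + (s choose 2) \<le> q"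
    then show "total_weight x {1..n} \<le> q - (s choose 2)"
      using total_weight_le_if_lt_half[of "{1..n}" s k x] k assms(2) by simp
  qed
  \<comment> \<open>The lower bound takes \<open>k\<close> edges at the vertex 1; no vertex set can
    contain more than \<open>k\<close> of them.\<close>
  have "k \<le> card {2..n}" using k assms(1,2) by auto
  then obtain A where A: "A \<subseteq> {2..n}" "card A = k" "finite A"
    by (rule obtain_subset_with_card_n)
  have "2 ^ card A \<le> ex_Pi n s q"
  proof (rule ex_Pi_ge_parent_edges[OF assms(1,2), where p = "\<lambda>_. 1"])
    fix X
    have "card {i \<in> A \<inter> X. 1 \<in> X} \<le> card A" using A by (intro card_mono) auto
    then show "card {i \<in> A \<inter> X. 1 \<in> X} + (s choose 2) \<le> q" using A k by simp
  qed (use A in auto)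
  then show "2 ^ (q - (s choose 2)) \<le> ex_Pi n s q" using A by (simp add: k_def)
qed

section \<open>Matchings, star forests and graphs of large girth\<close>

text \<open>The edges join \<open>2 * i - 1\<close> to \<open>2 * i\<close> and are stored by their
  even ends; being disjoint, at most \<open>s div 2\<close> of them fit into an
  \<open>s\<close>-set.\<close>

lemma ex_Pi_ge_matching:
  assumes "2 \<le> s" "s \<le> n" "(s choose 2) + s div 2 \<le> q"
  shows "2 ^ (n div 2) \<le> ex_Pi n s q"
proof -
  define A where "A = (\<lambda>i. 2 * i) ` {1..n div 2}"
  have "card A = n div 2" by (simp add: A_def card_image inj_on_def)
  moreover have "2 ^ card A \<le> ex_Pi n s q"
  proof (rule ex_Pi_ge_parent_edges[OF assms(1,2), where p = "\<lambda>i. i - 1"])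
    show "A \<subseteq> {1..n}" "\<And>i. i \<in> A \<Longrightarrow> 1 \<le> i - 1 \<and> i - 1 < i" by (auto simp: A_def)
    fix X assume X: "X \<subseteq> {1..n}" "card X = s"
    define I where "I = {i \<in> A \<inter> X. i - 1 \<in> X}"
    have finX: "finite X" using X finite_subset by blast
    have "inj_on (\<lambda>i. i - 1) I"
      by (auto simp: inj_on_def I_def A_def)
    then have c: "card ((\<lambda>i. i - 1) ` I) = card I" by (rule card_image)
    have "I \<inter> (\<lambda>i. i - 1) ` I = {}"
    proof -
      have "even i" if "i \<in> I" for i using that by (auto simp: I_def A_def)
      moreover have "odd (i - 1)" if "i \<in> I" for i using that by (auto simp: I_def A_def)
      ultimately show ?thesis by blast
    qed
    then have "card (I \<union> (\<lambda>i. i - 1) ` I) = 2 * card I"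
      using finX c by (subst card_Un_disjoint) (auto simp: I_def)
    moreover have "card (I \<union> (\<lambda>i. i - 1) ` I) \<le> card X"
      using finX by (intro card_mono) (auto simp: I_def)
    ultimately show "card {i \<in> A \<inter> X. i - 1 \<in> X} + (s choose 2) \<le> q"
      using X(2) assms(3) unfolding I_def[symmetric] by linarith
  qed
  ultimately show ?thesis by simp
qed

text \<open>\<open>Suc a\<close> is \<open>n / S\<close> rounded up, the number of stars in the
  forest below; \<open>c\<close> is its number of edges.\<close>

lemma pred_mult_div_eq:
  fixes S n a r c :: nat
  assumes n: "n = a * S + r + 1" and "r < S" and c: "c + Suc a = n"
  shows "((S - 1) * n) div S = c"
proof -
  obtain d where S: "S = Suc (r + d)" using less_imp_Suc_add[OF assms(2)] by blast
  have c': "c = a * (r + d) + r" using c unfolding n S by (simp add: algebra_simps)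
  have "(S - 1) * n = d + c * S" unfolding c' n S by (simp add: algebra_simps)
  then have "((S - 1) * n) div S = (d + c * S) div S" by simp
  moreover have "d < S" using S by simp
  ultimately show ?thesis by simp
qed

text \<open>The extremal configuration consists of disjoint stars on \<open>s - 1\<close> vertices each.\<close>

lemma ex_Pi_ge_star_forest:
  assumes "2 \<le> s" "s \<le> n" "(s choose 2) + (s - 2) \<le> q"
  shows "2 ^ (((s - 2) * n) div (s - 1)) \<le> ex_Pi n s q"
proof -
  define S where "S = s - 1"
  have S: "1 \<le> S" "s = Suc S" using assms(1) by (auto simp: S_def)
  \<comment> \<open>\<open>{1..n}\<close> is cut into blocks of \<open>S\<close> consecutive
    vertices, the last possibly shorter. The first vertex of a block is its centre; \<open>A\<close>
    omits the centres.\<close>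
  define A where "A = {i \<in> {1..n}. (i - 1) mod S \<noteq> 0}"
  define p where "p i = i - (i - 1) mod S" for i
  have p: "p i = Suc ((i - 1) div S * S)" if "1 \<le> i" for i
  proof -
    have "i - 1 = (i - 1) div S * S + (i - 1) mod S" by simp
    then show ?thesis using that unfolding p_def by linarith
  qed
  have cardA: "card A = ((s - 2) * n) div (s - 1)"
  proof -
    define a r where "a = (n - 1) div S" and "r = (n - 1) mod S"
    have n: "n = a * S + r + 1" "r < S" using S assms(1,2) by (auto simp: a_def r_def)
    have roots: "{1..n} - A = (\<lambda>j. Suc (j * S)) ` {0..a}"
    proof
      show "{1..n} - A \<subseteq> (\<lambda>j. Suc (j * S)) ` {0..a}"
      proof
        fix i assume i: "i \<in> {1..n} - A"
        then have "(i - 1) mod S = 0" "1 \<le> i" "i \<le> n" by (auto simp: A_def)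
        then have "i = Suc ((i - 1) div S * S)" using p[of i] by (simp add: p_def)
        moreover have "(i - 1) div S \<le> a" unfolding a_def using i by (intro div_le_mono) auto
        ultimately show "i \<in> (\<lambda>j. Suc (j * S)) ` {0..a}" by (intro image_eqI[of _ _ "(i-1) div S"]) auto
      qed
      show "(\<lambda>j. Suc (j * S)) ` {0..a} \<subseteq> {1..n} - A"
        using n by (auto simp: A_def trans_le_add1)
    qed
    have "card ({1..n} - A) = Suc a"
      unfolding roots using S by (subst card_image) (auto simp: inj_on_def)
    moreover have "card ({1..n} - A) = n - card A"
      by (subst card_Diff_subset) (auto simp: A_def)
    moreover have "card A \<le> card {1..n}" by (intro card_mono) (auto simp: A_def)
    ultimately have cA: "card A + Suc a = n" by simp
    have "((S - 1) * n) div S = card A" using pred_mult_div_eq[OF n cA] .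
    then show ?thesis by (simp add: S)
  qed
  have "2 ^ card A \<le> ex_Pi n s q"
  proof (rule ex_Pi_ge_parent_edges[OF assms(1,2), where p = p])
    show "A \<subseteq> {1..n}" by (auto simp: A_def)
    show "1 \<le> p i \<and> p i < i" if "i \<in> A" for i
      using that p[of i] by (auto simp: A_def p_def)
    fix X assume X: "X \<subseteq> {1..n}" "card X = s"
    define I where "I = {i \<in> A \<inter> X. p i \<in> X}"
    have finX: "finite X" using X finite_subset by blast
    define b where "b i = (i - 1) div S" for i :: nat
    \<comment> \<open>Each block met by \<open>X\<close> has a vertex of \<open>X\<close> outside
      \<open>I\<close>: its centre, or any of its vertices in \<open>X\<close> if the centre is not
      in \<open>X\<close>.\<close>
    have rep: "\<exists>i'\<in>X - I. b i' = b i" if i: "i \<in> X" for i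
    proof (cases "p i \<in> X")
      case True
      have "1 \<le> i" using i X by auto
      then have "(p i - 1) mod S = 0" "b (p i) = b i" using p[of i] S by (auto simp: b_def)
      then show ?thesis using True by (intro bexI[of _ "p i"]) (auto simp: I_def A_def)
    next
      case False
      then show ?thesis using i by (auto simp: I_def)
    qed
    \<comment> \<open>\<open>X\<close> has \<open>S + 1\<close> vertices, too many for one block;
      two blocks give two vertices outside \<open>I\<close>, whence at most \<open>s - 2\<close>
      edges.\<close>
    have "\<exists>i\<in>X. \<exists>j\<in>X. b i \<noteq> b j"
    proof (rule ccontr)
      assume no: "\<not> ?thesis"
      obtain i where i: "i \<in> X" using X S by fastforce
      have "X \<subseteq> {b i * S + 1..b i * S + S}"
      proof
        fix j assume j: "j \<in> X"
        then have "b j = b i" "1 \<le> j" using no i X by (blast, auto)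
        moreover have "j - 1 = b j * S + (j - 1) mod S" "(j - 1) mod S < S"
          using S unfolding b_def by (simp_all only: div_mult_mod_eq) simp
        ultimately have "j - 1 = b i * S + (j - 1) mod S" "(j - 1) mod S < S" by metis+
        then show "j \<in> {b i * S + 1..b i * S + S}" unfolding atLeastAtMost_iff using \<open>1 \<le> j\<close> by linarith
      qed
      then have "card X \<le> card {b i * S + 1..b i * S + S}" by (intro card_mono) auto
      then show False using X S by simp
    qed
    then obtain i j where "i \<in> X - I" "j \<in> X - I" "b i \<noteq> b j" using rep by metis
    then have "card {i, j} \<le> card (X - I)" "i \<noteq> j" using finX by (auto intro!: card_mono)
    moreover have "card (X - I) = card X - card I" "card I \<le> card X"
      using finX by (auto simp: I_def intro!: card_Diff_subset card_mono)
    ultimately have "card I + 2 \<le> s" using X by auto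
    then show "card {i \<in> A \<inter> X. p i \<in> X} + (s choose 2) \<le> q"
      using assms(3) unfolding I_def by linarith
  qed
  then show ?thesis by (simp add: cardA)
qed

lemma ex_Pi_le_star_forest:
  assumes "2 \<le> s" "s \<le> n" "q \<le> (s choose 2) + (s - 2)"
  shows "ex_Pi n s q \<le> 2 ^ (((s - 2) * n) div (s - 1))"
proof (rule ex_Pi_le_power2[OF assms(1,2)])
  fix x assume x: "\<And>X. X \<subseteq> {1..n} \<Longrightarrow> card X = s \<Longrightarrow> total_weight x X + (s choose 2) \<le> q"
  have "total_weight x X \<le> s - 2" if "X \<subseteq> {1..n}" "card X = s" for X
    using x[OF that] assms(3) by linarith
  then have "total_weight x {1..n} * (s - 1) \<le> (s - 2) * n"
    using linear_weight_bound[of "{1..n}" s "s - 2" x] assms(1,2) by simp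
  then show "total_weight x {1..n} \<le> ((s - 2) * n) div (s - 1)"
    using assms(1) by (simp add: less_eq_div_iff_mult_less_eq)
qed

text \<open>An \<open>s\<close>-set spans at most \<open>s - 1\<close> edges of a graph of girth
  larger than \<open>s\<close>; conversely, the total of an excess function within that budget is
  dominated by such a graph.\<close>

lemma ex_Pi_eq_girth:
  assumes "2 \<le> s" "s \<le> n" "q = (s choose 2) + (s - 1)"
  shows "ex_Pi n s q = 2 ^ ex_cycles n {3..s}"
proof (rule antisym)
  define Es where "Es = {E. E \<subseteq> nsets {1..n} 2 \<and> locally_sparse s E}"
  have ex: "ex_cycles n {3..s} = Max (card ` Es)"
    by (simp add: ex_cycles_def Es_def locally_sparse_iff_no_short_cycle)
  have fin: "finite (card ` Es)"
    by (rule finite_imageI, rule finite_subset[of _ "Pow (nsets {1..n} 2)"]) (auto simp: Es_def)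
  show "ex_Pi n s q \<le> 2 ^ ex_cycles n {3..s}"
  proof (rule ex_Pi_le_power2[OF assms(1,2)])
    fix x assume x: "\<And>X. X \<subseteq> {1..n} \<Longrightarrow> card X = s \<Longrightarrow> total_weight x X + (s choose 2) \<le> q"
    have "total_weight x X \<le> s - 1" if "X \<subseteq> {1..n}" "card X = s" for X
      using x[OF that] assms(3) by linarith
    then obtain E where "E \<in> Es" "total_weight x {1..n} \<le> card E"
      using locally_sparse_dominating_weight[of s "{1..n}" x] assms(1,2) by (auto simp: Es_def)
    then show "total_weight x {1..n} \<le> ex_cycles n {3..s}"
      unfolding ex using Max_ge[OF fin, of "card E"] by auto
  qed
  have "{} \<in> Es" by (auto simp: Es_def locally_sparse_def card_gt_0_iff)
  then have "card ` Es \<noteq> {}" by blast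
  from Max_in[OF fin this] obtain E where E: "E \<in> Es" "ex_cycles n {3..s} = card E"
    by (auto simp: ex)
  have "card (E \<inter> nsets X 2) + (s choose 2) \<le> q" if X: "X \<subseteq> {1..n}" "card X = s" for X
  proof -
    have "finite X" "X \<noteq> {}" using X assms(1) finite_subset by auto
    then have "card (E \<inter> nsets X 2) < s" using E(1) X by (auto simp: Es_def locally_sparse_def)
    then show ?thesis using assms(3) by linarith
  qed
  then show "2 ^ ex_cycles n {3..s} \<le> ex_Pi n s q"
    using ex_Pi_ge_power2_card[OF assms(1,2)] E by (auto simp: Es_def)
qed

section \<open>Dense weights and asymptotics\<close>

text \<open>Count in two ways the pairs of a vertex \<open>v\<close> and a \<open>t\<close>-subset
  of \<open>N v\<close>.\<close>

lemma sum_degree_choose_le: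
  assumes "finite V"
    and common: "\<And>A. A \<subseteq> V \<Longrightarrow> card A = t \<Longrightarrow> card {v \<in> V. A \<subseteq> N v} \<le> u"
    and N: "\<And>v. N v \<subseteq> V"
  shows "(\<Sum>v\<in>V. card (N v) choose t) \<le> u * (card V choose t)"
proof -
  have finN: "finite (N v)" for v using N assms(1) finite_subset by blast
  have "card (N v) choose t = (\<Sum>A\<in>nsets V t. of_bool (A \<subseteq> N v))" for v
  proof -
    have "nsets V t \<inter> {A. A \<subseteq> N v} = nsets (N v) t" using N[of v] by (auto simp: nsets_def)
    then show ?thesis
      using finite_imp_finite_nsets[OF assms(1)] finN[of v] by (simp add: card_nsets)
  qed
  then have "(\<Sum>v\<in>V. card (N v) choose t) = (\<Sum>v\<in>V. \<Sum>A\<in>nsets V t. of_bool (A \<subseteq> N v))"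
    by simp
  also have "\<dots> = (\<Sum>A\<in>nsets V t. \<Sum>v\<in>V. of_bool (A \<subseteq> N v))" by (rule sum.swap)
  also have "\<dots> \<le> (\<Sum>A\<in>nsets V t. u)"
  proof (rule sum_mono)
    fix A assume "A \<in> nsets V t"
    then have "card {v \<in> V. A \<subseteq> N v} \<le> u" by (intro common) (auto simp: nsets_def)
    then show "(\<Sum>v\<in>V. of_bool (A \<subseteq> N v)) \<le> u" using assms(1) by (simp add: Int_def)
  qed
  also have "\<dots> = u * (card V choose t)" using assms(1) by (simp add: card_nsets)
  finally show ?thesis .
qed

text \<open>With a larger degree sum, at least \<open>\<delta> * n\<close> vertices have degree at
  least \<open>\<delta> * n\<close>, since the others account for only half of it. Each has at least
  \<open>(\<delta> * n / t) ^ t\<close> subsets of size \<open>t\<close> among its neighbours, in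
  total more than \<open>u * n ^ t\<close>. The degree threshold replaces the usual convexity
  argument.\<close>

lemma sum_degree_lt_if_few_common_neighbours:
  fixes \<delta> :: real
  assumes "finite V"
    and common: "\<And>A. A \<subseteq> V \<Longrightarrow> card A = t \<Longrightarrow> card {v \<in> V. A \<subseteq> N v} \<le> u"
    and N: "\<And>v. N v \<subseteq> V" and "0 < \<delta>" "1 \<le> t"
    and large: "real t \<le> \<delta> * card V" "real u * real t ^ t < \<delta> ^ Suc t * card V"
  shows "real (\<Sum>v\<in>V. card (N v)) < 2 * \<delta> * (card V)\<^sup>2"
proof (rule ccontr)
  define n where "n = card V"
  define d where "d v = card (N v)" for v
  define H where "H = {v \<in> V. \<delta> * n \<le> d v}"
  assume "\<not> ?thesis"
  then have many: "2 * \<delta> * (real n)\<^sup>2 \<le> (\<Sum>v\<in>V. real (d v))" by (simp add: n_def d_def)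
  have n0: "0 < real n" using large(1) assms(4,5) by (cases "card V = 0") (auto simp: n_def)
  have HV: "H \<subseteq> V" "finite H" using assms(1) by (auto simp: H_def)
  have dn: "d v \<le> n" for v unfolding d_def n_def using N assms(1) by (intro card_mono)
  have "(\<Sum>v\<in>V. real (d v)) = (\<Sum>v\<in>V - H. real (d v)) + (\<Sum>v\<in>H. real (d v))"
    using HV assms(1) by (simp add: sum.subset_diff)
  also have "(\<Sum>v\<in>V - H. real (d v)) \<le> (\<Sum>v\<in>V - H. \<delta> * n)"
    by (intro sum_mono) (auto simp: H_def)
  also have "\<dots> \<le> real n * (\<delta> * n)"
    using assms(1,4) by (auto simp: n_def intro!: mult_right_mono card_mono)
  also have "(\<Sum>v\<in>H. real (d v)) \<le> (\<Sum>v\<in>H. real n)" using dn by (intro sum_mono) simp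
  also have "\<dots> = real (card H) * real n" by simp
  finally have "\<delta> * n * n \<le> real (card H) * n" using many by (simp add: power2_eq_square algebra_simps)
  then have H: "\<delta> * n \<le> real (card H)" using n0 by simp
  have "(\<delta> * n) * (\<delta> * n / t) ^ t \<le> real (card H) * (\<delta> * n / t) ^ t"
    using H assms(4) by (intro mult_right_mono) auto
  also have "\<dots> = (\<Sum>v\<in>H. (\<delta> * n / t) ^ t)" by simp
  also have "\<dots> \<le> (\<Sum>v\<in>H. real (d v choose t))"
  proof (rule sum_mono)
    fix v assume "v \<in> H"
    then have dv: "\<delta> * n \<le> d v" by (simp add: H_def)
    then have "t \<le> d v" using large(1) by (simp add: n_def)
    have "(\<delta> * n / t) ^ t \<le> (real (d v) / real t) ^ t"
      using dv assms(4) by (intro power_mono divide_right_mono) auto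
    also have "\<dots> \<le> real (d v choose t)" using binomial_ge_n_over_k_pow_k[OF \<open>t \<le> d v\<close>] .
    finally show "(\<delta> * n / t) ^ t \<le> real (d v choose t)" .
  qed
  also have "\<dots> \<le> (\<Sum>v\<in>V. real (d v choose t))" using HV assms(1) by (intro sum_mono2) auto
  also have "\<dots> \<le> real (u * (n choose t))"
    using sum_degree_choose_le[OF assms(1) common N]
    unfolding d_def n_def of_nat_sum[symmetric] of_nat_le_iff .
  also have "\<dots> \<le> real u * real n ^ t"
  proof -
    have "n choose t \<le> n ^ t" using dn large(1)
      by (cases "t \<le> n") (auto simp: binomial_le_pow binomial_eq_0)
    then have "real (n choose t) \<le> real n ^ t" by (metis of_nat_le_iff of_nat_power)
    then show ?thesis by (auto intro!: mult_left_mono)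
  qed
  finally have "\<delta> ^ Suc t * n * real n ^ t \<le> real u * real t ^ t * real n ^ t"
    using assms(5) by (simp add: power_divide power_mult_distrib field_simps)
  then have "\<delta> ^ Suc t * n \<le> real u * real t ^ t" using n0 by simp
  then show False using large(2) by (simp add: n_def)
qed

lemma support_card_lt:
  fixes \<delta> :: real
  assumes "finite V" "2 \<le> s" "0 < \<delta>" "k < s\<^sup>2 div 4"
    and x: "\<And>X. X \<subseteq> V \<Longrightarrow> card X = s \<Longrightarrow> total_weight x X \<le> k"
    and large: "real (s div 2) \<le> \<delta> * card V"
      "real s * real (s div 2) ^ (s div 2) < \<delta> ^ Suc (s div 2) * card V"
  shows "real (card {e \<in> nsets V 2. 0 < x e}) < 2 * \<delta> * (card V)\<^sup>2"
proof -
  define t u where "t = s div 2" and "u = s - s div 2"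
  have tu: "t + u = s" "1 \<le> t" "u \<le> s" using assms(2) by (auto simp: t_def u_def)
  have tus: "t * u = s\<^sup>2 div 4"
  proof (cases "even s")
    case True
    then obtain m where "s = 2 * m" by blast
    then show ?thesis by (simp add: t_def u_def power2_eq_square)
  next
    case False
    then obtain m where "s = 2 * m + 1" using oddE by blast
    then have "t = m" "u = Suc m" "s\<^sup>2 = 1 + (m * Suc m) * 4"
      by (auto simp: t_def u_def power2_eq_square algebra_simps)
    then show ?thesis by simp
  qed
  \<comment> \<open>Leaving out \<open>v\<close> keeps a set disjoint from its common
    neighbours.\<close>
  define N where "N v = {a \<in> V - {v}. 0 < x {a,v}}" for v
  have "card {v \<in> V. A \<subseteq> N v} \<le> s" if A: "A \<subseteq> V" "card A = t" for A
  proof (rule ccontr)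
    assume "\<not> ?thesis"
    then have "u \<le> card {v \<in> V. A \<subseteq> N v}" using tu by simp
    then obtain B where B: "B \<subseteq> {v \<in> V. A \<subseteq> N v}" "card B = u" "finite B"
      by (rule obtain_subset_with_card_n)
    have finA: "finite A" using A assms(1) finite_subset by blast
    have disj: "A \<inter> B = {}" using B by (auto simp: N_def)
    have "t * u = (\<Sum>a\<in>A. \<Sum>b\<in>B. 1)" using A B by simp
    also have "\<dots> \<le> (\<Sum>a\<in>A. \<Sum>b\<in>B. x {a,b})"
    proof (intro sum_mono)
      fix a b assume "a \<in> A" "b \<in> B"
      then have "a \<in> N b" using B by auto
      then show "1 \<le> x {a,b}" by (simp add: N_def)
    qed
    also have "\<dots> \<le> total_weight x (A \<union> B)" using total_weight_Un[OF finA B(3) disj, of x] by simp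
    also have "\<dots> \<le> k"
    proof (rule x)
      show "A \<union> B \<subseteq> V" using A B by auto
      show "card (A \<union> B) = s" using card_Un_disjoint[OF finA B(3) disj] A B tu by simp
    qed
    finally show False using tus assms(4) by simp
  qed
  then have "real (\<Sum>v\<in>V. card (N v)) < 2 * \<delta> * (card V)\<^sup>2"
    using large assms(1,3) tu(2)
    by (intro sum_degree_lt_if_few_common_neighbours[where t = t and u = s])
      (auto simp: t_def N_def)
  moreover have "card {e \<in> nsets V 2. 0 < x e} \<le> (\<Sum>v\<in>V. card (N v))"
  proof -
    have fin: "finite (Sigma V N)" using assms(1) by (auto simp: N_def)
    have "{e \<in> nsets V 2. 0 < x e} \<subseteq> (\<lambda>(v,a). {a,v}) ` Sigma V N"
    proof
      fix e assume "e \<in> {e \<in> nsets V 2. 0 < x e}"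
      then have e: "e \<in> nsets V 2" "0 < x e" by auto
      obtain a v where "e = {a,v}" "a \<in> V" "v \<in> V" "a \<noteq> v" using nsets2_E[OF e(1)] .
      then show "e \<in> (\<lambda>(v,a). {a,v}) ` Sigma V N"
        using e by (intro image_eqI[of _ _ "(v,a)"]) (auto simp: N_def)
    qed
    then have "card {e \<in> nsets V 2. 0 < x e} \<le> card ((\<lambda>(v,a). {a,v}) ` Sigma V N)"
      using fin by (intro card_mono) auto
    also have "\<dots> \<le> card (Sigma V N)" using fin by (rule card_image_le)
    also have "\<dots> = (\<Sum>v\<in>V. card (N v))" using assms(1) by (auto simp: N_def)
    finally show ?thesis .
  qed
  ultimately show ?thesis by (meson le_less_trans of_nat_le_iff)
qed

text \<open>Only pairs of positive excess contribute a factor other than 1, and each factor is at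
  most \<open>q\<close>.\<close>

lemma ex_Pi_le_subquadratic:
  fixes \<delta> :: real
  assumes "2 \<le> s" "s \<le> n" "0 < \<delta>" "s choose 2 \<le> q" "q < (s choose 2) + s\<^sup>2 div 4"
    and large: "real (s div 2) \<le> \<delta> * n"
      "real s * real (s div 2) ^ (s div 2) < \<delta> ^ Suc (s div 2) * n"
  shows "ex_Pi n s q \<le> q ^ nat \<lfloor>2 * \<delta> * n\<^sup>2\<rfloor>"
proof (rule ex_Pi_le[OF assms(1,2)])
  fix x assume x: "\<And>X. X \<subseteq> {1..n} \<Longrightarrow> card X = s \<Longrightarrow> total_weight x X + (s choose 2) \<le> q"
  define E where "E = {e \<in> nsets {1..n} 2. 0 < x e}"
  have s2: "1 \<le> s choose 2" using assms(1) by (simp add: Suc_le_eq)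
  have small: "total_weight x X \<le> q - (s choose 2)" if "X \<subseteq> {1..n}" "card X = s" for X
    using x[OF that] by simp
  have "real (card E) < 2 * \<delta> * n\<^sup>2"
    using support_card_lt[of "{1..n}" s \<delta> "q - (s choose 2)" x] small assms by (auto simp: E_def)
  then have "card E \<le> nat \<lfloor>2 * \<delta> * n\<^sup>2\<rfloor>" by (simp add: le_nat_floor)
  have "Suc (x e) \<le> q" if e: "e \<in> nsets {1..n} 2" for e
  proof -
    have "e \<subseteq> {1..n}" "card e = 2" using e by (auto simp: nsets_def)
    then have "total_weight x e \<le> q - (s choose 2)"
      using total_weight_le_if_subset_card[of "{1..n}" s x _ e] small assms(1,2) by auto
    moreover have "total_weight x e = x e"
      using e by (auto elim!: nsets2_E simp: total_weight_def)
    ultimately show ?thesis using s2 assms(4) by simp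
  qed
  then have "(\<Prod>e\<in>E. Suc (x e)) \<le> (\<Prod>e\<in>E. q)" by (intro prod_mono) (auto simp: E_def)
  also have "\<dots> = q ^ card E" by simp
  also have "\<dots> \<le> q ^ nat \<lfloor>2 * \<delta> * n\<^sup>2\<rfloor>"
    using \<open>card E \<le> _\<close> s2 assms(4) by (intro power_increasing) auto
  also have "(\<Prod>e\<in>E. Suc (x e)) = (\<Prod>e\<in>nsets {1..n} 2. Suc (x e))"
    by (intro prod.mono_neutral_left) (auto simp: E_def)
  finally show "(\<Prod>e\<in>nsets {1..n} 2. Suc (x e)) \<le> q ^ nat \<lfloor>2 * \<delta> * n\<^sup>2\<rfloor>" .
qed

text \<open>An \<open>s\<close>-set meeting the two parts in \<open>a\<close> and \<open>b\<close>
  vertices spans at most \<open>a * b\<close> edges, which is at most a quarter of the square of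
  \<open>a + b\<close>.\<close>

lemma ex_Pi_ge_bipartite:
  assumes "2 \<le> s" "s \<le> n" "(s choose 2) + s\<^sup>2 div 4 \<le> q"
  shows "2 ^ ((n div 2) * (n div 2)) \<le> ex_Pi n s q"
proof -
  define m where "m = n div 2"
  define A B where "A = {1..m}" and "B = {m + 1..2 * m}"
  have mn: "2 * m \<le> n" by (simp add: m_def)
  define E where "E = (\<lambda>(a,b). {a,b}) ` (A \<times> B)"
  have "inj_on (\<lambda>(a,b). {a,b}) (A \<times> B)"
    by (auto simp: inj_on_def doubleton_eq_iff A_def B_def)
  then have "card E = m * m" by (simp add: E_def card_image A_def B_def card_cartesian_product)
  moreover have "E \<subseteq> nsets {1..n} 2" using mn by (auto simp: E_def A_def B_def)
  moreover have "card (E \<inter> nsets X 2) + (s choose 2) \<le> q" if X: "X \<subseteq> {1..n}" "card X = s" for X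
  proof -
    define a b where "a = card (X \<inter> A)" and "b = card (X \<inter> B)"
    have finX: "finite X" using X finite_subset by blast
    have "(X \<inter> A) \<inter> (X \<inter> B) = {}" by (auto simp: A_def B_def)
    then have "a + b = card (X \<inter> A \<union> X \<inter> B)" using finX by (simp add: a_def b_def card_Un_disjoint)
    also have "\<dots> \<le> s" using finX X(2) by (metis Int_Un_distrib card_mono inf_le1)
    finally have ab: "a + b \<le> s" .
    have "E \<inter> nsets X 2 \<subseteq> (\<lambda>(a,b). {a,b}) ` ((X \<inter> A) \<times> (X \<inter> B))"
      by (auto simp: E_def)
    then have "card (E \<inter> nsets X 2) \<le> card ((\<lambda>(a,b). {a,b}) ` ((X \<inter> A) \<times> (X \<inter> B)))"
      using finX by (intro card_mono) auto
    also have "\<dots> \<le> card ((X \<inter> A) \<times> (X \<inter> B))" using finX by (intro card_image_le) auto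
    also have "\<dots> = a * b" by (simp add: a_def b_def card_cartesian_product)
    also have "a * b \<le> s\<^sup>2 div 4"
    proof -
      have "int (4 * (a * b)) \<le> (int a + int b)\<^sup>2"
        using zero_le_power2[of "int a - int b"] by (simp add: power2_eq_square algebra_simps)
      also have "(int a + int b)\<^sup>2 \<le> (int s)\<^sup>2" using ab by (intro power_mono) auto
      finally have "4 * (a * b) \<le> s\<^sup>2" by (metis of_nat_le_iff of_nat_power)
      then show ?thesis by simp
    qed
    finally show ?thesis using assms(3) by simp
  qed
  ultimately show ?thesis
    using ex_Pi_ge_power2_card[OF assms(1,2), of E q] by (simp add: m_def)
qed

lemma ex_Pi_le_quadratic:
  assumes "2 \<le> s" "s \<le> n" "1 \<le> q"
  shows "ex_Pi n s q \<le> q ^ n\<^sup>2"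
proof -
  obtain G where "G \<in> sq_multigraphs n s q" "ex_Pi n s q = edge_prod G"
    using ex_Pi_attained[OF assms(1,2)] by blast
  then have "ex_Pi n s q \<le> q ^ (n choose 2)" using edge_prod_le_power[OF assms(1,2)] by simp
  also have "n choose 2 \<le> n\<^sup>2" using assms(1,2) by (intro binomial_le_pow) auto
  then have "q ^ (n choose 2) \<le> q ^ n\<^sup>2" using assms(3) by (intro power_increasing) auto
  finally show ?thesis .
qed

section \<open>Logarithms and growth rates\<close>

lemma log2_le_of_le_power:
  fixes F q m :: nat
  assumes "1 \<le> F" "F \<le> q ^ m"
  shows "log 2 (real F) \<le> real m * log 2 (real q)"
proof (cases "m = 0")
  case True
  then show ?thesis using assms by simp
next
  case False
  then have q: "0 < q" using assms by (cases "q = 0") (auto simp: power_0_left)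
  have "real F \<le> real q ^ m" using assms(2) by (metis of_nat_le_iff of_nat_power)
  then have "log 2 (real F) \<le> log 2 (real q ^ m)" using assms(1) q by (subst log_le_cancel_iff) auto
  also have "\<dots> = real m * log 2 (real q)" using q by (simp add: log_nat_power)
  finally show ?thesis .
qed

lemma log2_ge_of_ge_power:
  fixes F m :: nat
  assumes "2 ^ m \<le> F"
  shows "real m \<le> log 2 (real F)"
proof -
  have "(2::real) ^ m \<le> real F" using assms by (metis of_nat_le_iff of_nat_numeral of_nat_power)
  then show ?thesis by (simp add: le_log_of_power)
qed

lemma eventually_eq_2_powr_log:
  fixes F :: "nat \<Rightarrow> nat"
  assumes "\<forall>\<^sub>F n in at_top. 1 \<le> F n"
  shows "\<forall>\<^sub>F n in at_top. real (F n) = 2 powr log 2 (real (F n))"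
  using assms by eventually_elim simp

text \<open>The exponent is the base 2 logarithm of the value, so two-sided bounds on that logarithm
  suffice.\<close>

lemma eq_2_powr_bigtheta:
  fixes F :: "nat \<Rightarrow> nat" and g :: "nat \<Rightarrow> real"
  assumes "\<forall>\<^sub>F n in at_top. 1 \<le> F n" "0 < c" "\<And>n. 0 \<le> g n"
    and "\<forall>\<^sub>F n in at_top. c * g n \<le> log 2 (F n)" "\<forall>\<^sub>F n in at_top. log 2 (F n) \<le> C * g n"
  shows "\<exists>f \<in> \<Theta>(g). \<forall>\<^sub>F n in at_top. real (F n) = 2 powr f n"
proof (intro bexI[of _ "\<lambda>n. log 2 (real (F n))"] bigthetaI)
  show "\<forall>\<^sub>F n in at_top. real (F n) = 2 powr log 2 (real (F n))"
    by (rule eventually_eq_2_powr_log[OF assms(1)])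
  show "(\<lambda>n. log 2 (real (F n))) \<in> O(g)"
  proof (rule bigoI[of _ C])
    show "\<forall>\<^sub>F n in at_top. norm (log 2 (real (F n))) \<le> C * norm (g n)"
      using assms(1,5) by eventually_elim (use assms(3) in auto)
  qed
  show "(\<lambda>n. log 2 (real (F n))) \<in> \<Omega>(g)"
  proof (rule landau_omega.bigI[OF assms(2)])
    show "\<forall>\<^sub>F n in at_top. c * norm (g n) \<le> norm (log 2 (real (F n)))"
      using assms(1,4) by eventually_elim (use assms(3) in auto)
  qed
qed

lemma ex_Pi_linear:
  assumes "2 \<le> s" "(s choose 2) + s div 2 \<le> q" "q \<le> (s choose 2) + (s - 2)"
  shows "\<exists>f \<in> \<Theta>(\<lambda>n. real n). \<forall>\<^sub>F n in at_top. real (ex_Pi n s q) = 2 powr f n"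
\<comment> \<open>\<open>1/4\<close> comes from \<open>n \<le> 4 * (n div 2)\<close> for
  \<open>n\<close> at least 2, and \<open>C = 1\<close> from the ratio of \<open>s - 2\<close> to
  \<open>s - 1\<close>.\<close>
proof (rule eq_2_powr_bigtheta[where c = "1/4" and C = 1])
  have ge: "\<forall>\<^sub>F n in at_top. s \<le> n" by (rule eventually_ge_at_top)
  then show ge1: "\<forall>\<^sub>F n in at_top. 1 \<le> ex_Pi n s q"
    by eventually_elim (rule ex_Pi_ge_1, use assms in auto)
  show "\<forall>\<^sub>F n in at_top. 1/4 * real n \<le> log 2 (ex_Pi n s q)"
    using ge
  proof eventually_elim
    case (elim n)
    have "real (n div 2) \<le> log 2 (ex_Pi n s q)"
      using ex_Pi_ge_matching[OF assms(1) elim assms(2)] by (rule log2_ge_of_ge_power)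
    moreover have "n \<le> 4 * (n div 2)" using elim assms(1) by linarith
    then have "real n \<le> 4 * real (n div 2)" by linarith
    ultimately show ?case by linarith
  qed
  show "\<forall>\<^sub>F n in at_top. log 2 (ex_Pi n s q) \<le> 1 * real n"
    using ge ge1
  proof eventually_elim
    case (elim n)
    have "(s - 2) * n \<le> n * (s - 1)" by (simp add: mult.commute diff_le_mono2)
    then have "((s - 2) * n) div (s - 1) \<le> n"
      using assms(1) div_le_mono[of "(s - 2) * n" "n * (s - 1)" "s - 1"] by simp
    then have "(2::nat) ^ (((s - 2) * n) div (s - 1)) \<le> 2 ^ n" by (intro power_increasing) auto
    then have "ex_Pi n s q \<le> 2 ^ n"
      using ex_Pi_le_star_forest[OF assms(1) elim(1) assms(3)] by linarith
    then show ?case using log2_le_of_le_power[OF elim(2), of 2 n] by simp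
  qed
qed auto

lemma ex_Pi_quadratic:
  assumes "2 \<le> s" "(s choose 2) + s\<^sup>2 div 4 \<le> q"
  shows "\<exists>f \<in> \<Theta>(\<lambda>n. (real n)\<^sup>2). \<forall>\<^sub>F n in at_top. real (ex_Pi n s q) = 2 powr f n"
\<comment> \<open>\<open>1/16\<close> is the square of the loss in
  \<open>n \<le> 4 * (n div 2)\<close>; \<open>C\<close> comes from the bound
  \<open>q ^ n\<^sup>2\<close>.\<close>
proof (rule eq_2_powr_bigtheta[where c = "1/16" and C = "log 2 q"])
  have ge: "\<forall>\<^sub>F n in at_top. s \<le> n" by (rule eventually_ge_at_top)
  have q: "1 \<le> q" using assms zero_less_binomial[of 2 s] by linarith
  from ge show ge1: "\<forall>\<^sub>F n in at_top. 1 \<le> ex_Pi n s q"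
    by eventually_elim (rule ex_Pi_ge_1, use assms in auto)
  show "\<forall>\<^sub>F n in at_top. 1/16 * (real n)\<^sup>2 \<le> log 2 (ex_Pi n s q)"
    using ge
  proof eventually_elim
    case (elim n)
    have "real (n div 2 * (n div 2)) \<le> log 2 (ex_Pi n s q)"
      using ex_Pi_ge_bipartite[OF assms(1) elim assms(2)] by (rule log2_ge_of_ge_power)
    moreover have "n \<le> 4 * (n div 2)" using elim assms(1) by linarith
    then have "real n \<le> 4 * real (n div 2)" by linarith
    then have "(real n)\<^sup>2 \<le> (4 * real (n div 2))\<^sup>2" by (intro power_mono) auto
    ultimately show ?case by (simp add: power2_eq_square)
  qed
  show "\<forall>\<^sub>F n in at_top. log 2 (ex_Pi n s q) \<le> log 2 q * (real n)\<^sup>2"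
    using ge ge1
  proof eventually_elim
    case (elim n)
    show ?case
      using log2_le_of_le_power[OF elim(2) ex_Pi_le_quadratic[OF assms(1) elim(1) q]]
      by (simp add: mult.commute)
  qed
qed auto

lemma ex_Pi_subquadratic:
  assumes "2 \<le> s" "s choose 2 \<le> q" "q < (s choose 2) + s\<^sup>2 div 4"
  shows "\<exists>f \<in> o(\<lambda>n. (real n)\<^sup>2). \<forall>\<^sub>F n in at_top. real (ex_Pi n s q) = 2 powr f n"
proof (intro bexI[of _ "\<lambda>n. log 2 (real (ex_Pi n s q))"] landau_o.smallI)
  have ge: "\<forall>\<^sub>F n in at_top. s \<le> n" by (rule eventually_ge_at_top)
  then have ge1: "\<forall>\<^sub>F n in at_top. 1 \<le> ex_Pi n s q"
    by eventually_elim (rule ex_Pi_ge_1, use assms in auto)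
  show "\<forall>\<^sub>F n in at_top. real (ex_Pi n s q) = 2 powr log 2 (real (ex_Pi n s q))"
    by (rule eventually_eq_2_powr_log[OF ge1])
  fix c :: real assume c: "0 < c"
  have "0 < s choose 2" using assms(1) by simp
  then have "1 \<le> q" using assms(2) by linarith
  then have q: "0 \<le> log 2 (real q)" by simp
  \<comment> \<open>Makes \<open>2 * \<delta> * log 2 q\<close> at most \<open>c\<close>; the
    \<open>+ 1\<close> guards against \<open>q = 1\<close>, where the logarithm vanishes.\<close>
  define \<delta> where "\<delta> = c / (2 * (log 2 q + 1))"
  have \<delta>: "0 < \<delta>" using c q by (simp add: \<delta>_def)
  define t where "t = s div 2"
  have "\<forall>\<^sub>F n in at_top. real t / \<delta> \<le> real n"
    by (rule eventually_at_top_linorderI[of "nat \<lceil>real t / \<delta>\<rceil>"]) linarith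
  moreover have "\<forall>\<^sub>F n in at_top. real s * real t ^ t / \<delta> ^ Suc t < real n"
    using eventually_gt_at_top[of "nat \<lceil>real s * real t ^ t / \<delta> ^ Suc t\<rceil>"]
    by eventually_elim linarith
  ultimately show "\<forall>\<^sub>F n in at_top. norm (log 2 (real (ex_Pi n s q))) \<le> c * norm ((real n)\<^sup>2)"
    using ge ge1
  proof eventually_elim
    case (elim n)
    have "real (s div 2) \<le> \<delta> * n" using elim(1) \<delta> by (simp add: t_def pos_divide_le_eq mult.commute)
    moreover have "real s * real (s div 2) ^ (s div 2) < \<delta> ^ Suc (s div 2) * n"
      using elim(2) \<delta> unfolding t_def by (subst (asm) pos_divide_less_eq) (auto simp: mult.commute)
    ultimately have "ex_Pi n s q \<le> q ^ nat \<lfloor>2 * \<delta> * n\<^sup>2\<rfloor>"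
      using ex_Pi_le_subquadratic[OF assms(1) elim(3) \<delta> assms(2,3)] by blast
    then have "log 2 (ex_Pi n s q) \<le> real (nat \<lfloor>2 * \<delta> * n\<^sup>2\<rfloor>) * log 2 q"
      using elim(4) by (intro log2_le_of_le_power)
    also have "\<dots> \<le> 2 * \<delta> * n\<^sup>2 * log 2 q" using q \<delta> by (intro mult_right_mono) auto
    also have "\<dots> \<le> 2 * \<delta> * n\<^sup>2 * (log 2 q + 1)" using \<delta> by (intro mult_left_mono) auto
    also have "\<dots> = c * (real n)\<^sup>2" using q by (simp add: \<delta>_def field_simps)
    finally show ?case using elim(4) by simp
  qed
qed

text \<open>For small \<open>s\<close> the clauses overlap: \<open>s = 2\<close>,
  \<open>q = 2\<close> falls both under the girth clause, with no forbidden cycle, and under the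
  quadratic one. Asymptotic equalities hold eventually because \<open>ex_Pi\<close> is meaningful
  for \<open>n\<close> at least \<open>s\<close>.\<close>

theorem theorem3p12:
  fixes s q :: nat
  assumes "s \<ge> 2" and "q \<le> 2 * (s choose 2)"
  shows
    "(q < (s choose 2) \<longrightarrow> (\<forall>n\<ge>s. ex_Pi n s q = 0)) \<and>
     (q = (s choose 2) \<longrightarrow> (\<forall>n\<ge>s. ex_Pi n s q = 1)) \<and>
     ((s choose 2) < q \<and> q < (s choose 2) + s div 2 \<longrightarrow>
        (\<forall>n\<ge>s. ex_Pi n s q = 2 ^ (q - (s choose 2)))) \<and>
     ((s choose 2) + s div 2 \<le> q \<and> q < (s choose 2) + (s - 2) \<longrightarrow>
        (\<exists>f \<in> \<Theta>(\<lambda>n. real n). \<forall>\<^sub>F n in at_top. real (ex_Pi n s q) = 2 powr f n)) \<and>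
     (q = (s choose 2) + (s - 2) \<longrightarrow>
        (\<forall>n\<ge>s. ex_Pi n s q = 2 ^ (((s - 2) * n) div (s - 1)))) \<and>
     (q = (s choose 2) + (s - 1) \<longrightarrow>
        (\<forall>n\<ge>s. ex_Pi n s q = 2 ^ ex_cycles n {3..s})) \<and>
     ((s choose 2) + s \<le> q \<and> q < (s choose 2) + s\<^sup>2 div 4 \<longrightarrow>
        (\<exists>f \<in> o(\<lambda>n. (real n)\<^sup>2). \<forall>\<^sub>F n in at_top. real (ex_Pi n s q) = 2 powr f n)) \<and>
     ((s choose 2) + s\<^sup>2 div 4 \<le> q \<and> q \<le> 2 * (s choose 2) \<longrightarrow>
        (\<exists>f \<in> \<Theta>(\<lambda>n. (real n)\<^sup>2). \<forall>\<^sub>F n in at_top. real (ex_Pi n s q) = 2 powr f n))"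
proof (intro conjI impI allI; (elim conjE)?)
  note s = assms(1)
  fix n assume n: "s \<le> n"
  show "ex_Pi n s q = 0" if "q < s choose 2" using ex_Pi_eq_0[OF s n that] .
  \<comment> \<open>The case of exponent 0 in the range below \<open>s div 2\<close>, which is
    positive as \<open>s\<close> is at least 2.\<close>
  show "ex_Pi n s q = 1" if "q = s choose 2" using ex_Pi_lt_half[OF s n, of q] that s by simp
  show "ex_Pi n s q = 2 ^ (q - (s choose 2))" if "s choose 2 < q" "q < (s choose 2) + s div 2"
    using ex_Pi_lt_half[OF s n, of q] that by simp
  show "ex_Pi n s q = 2 ^ (((s - 2) * n) div (s - 1))" if "q = (s choose 2) + (s - 2)"
    using that by (intro antisym ex_Pi_le_star_forest ex_Pi_ge_star_forest s n) auto
  show "ex_Pi n s q = 2 ^ ex_cycles n {3..s}" if "q = (s choose 2) + (s - 1)"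
    using ex_Pi_eq_girth[OF s n that] .
next
  note s = assms(1)
  show "\<exists>f \<in> \<Theta>(\<lambda>n. real n). \<forall>\<^sub>F n in at_top. real (ex_Pi n s q) = 2 powr f n"
    if "(s choose 2) + s div 2 \<le> q" "q < (s choose 2) + (s - 2)"
    using ex_Pi_linear[OF s, of q] that by simp
  show "\<exists>f \<in> o(\<lambda>n. (real n)\<^sup>2). \<forall>\<^sub>F n in at_top. real (ex_Pi n s q) = 2 powr f n"
    if "(s choose 2) + s \<le> q" "q < (s choose 2) + s\<^sup>2 div 4"
    using ex_Pi_subquadratic[OF s, of q] that by simp
  show "\<exists>f \<in> \<Theta>(\<lambda>n. (real n)\<^sup>2). \<forall>\<^sub>F n in at_top. real (ex_Pi n s q) = 2 powr f n"
    if "(s choose 2) + s\<^sup>2 div 4 \<le> q" "q \<le> 2 * (s choose 2)"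
    using ex_Pi_quadratic[OF s, of q] that by simp
qed

end
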